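(* Let $N\ge 1$, $1<p<\infty$, $h>0$. Let $J\in C^1(\mathbb{R}^N)$ be non-negative, even and supported in the ball of center $0$ and radius $1$. Let $f:\mathbb{R}\to\mathbb{R}$ be non-negative, nondecreasing and globally Lipschitz (there is $k_1>0$ with $|f(x)-f(y)|\le k_1|x-y|$ for all $x,y\in\mathbb{R}$). Let $\rho:\mathbb{R}^N\to\mathbb{R}$ be an integrable positive even function with $\int_{\mathbb{R}^N}\rho(x)\,dx=1$, and suppose there is a constant $K>0$ such that $\sup\{\rho(x): x\in\mathbb{R}^N,\ |x-y|\le 1\}\le K\rho(y)$ for all $y\in\mathbb{R}^N$. Then the Cauchy problem for $$\frac{\partial u}{\partial t}(x,t)=-u(x,t)+\int_{\mathbb{R}^N}J(x-y)f(u(y,t))\,dy+h$$ is well posed in $L^p(\mathbb{R}^N,\rho)$ with globally defined solutions.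
   Context: $L^p(\mathbb{R}^N,\rho)=\{u\in L^1_{\rm loc}(\mathbb{R}^N):\int_{\mathbb{R}^N}|u(x)|^p\rho(x)\,dx<\infty\}$ with norm $\|u\|_{L^p(\mathbb{R}^N,\rho)}=\left(\int_{\mathbb{R}^N}|u(x)|^p\rho(x)\,dx\right)^{1/p}$. The equation is regarded as the ODE $\dot u=-u+J*(f\circ u)+h$ in the Banach space $L^p(\mathbb{R}^N,\rho)$, where $(J*v)(x)=\int_{\mathbb{R}^N}J(x-y)v(y)\,dy$ and $h$ is the constant function. "Well posed with globally defined solutions" means: for every $u_0\in L^p(\mathbb{R}^N,\rho)$ there is a unique $u\in C^1([0,\infty);L^p(\mathbb{R}^N,\rho))$ solving the equation with $u(0)=u_0$, and for each $t\ge0$ the map $u_0\mapsto u(t)$ is continuous. *)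

theory Defs
  imports "HOL-Analysis.Analysis"
begin

definition C1_function :: "('a::real_normed_vector \<Rightarrow> 'b::real_normed_vector) \<Rightarrow> bool" where
  "C1_function g \<longleftrightarrow>
     (\<exists>g'. (\<forall>x. (g has_derivative blinfun_apply (g' x)) (at x)) \<and> continuous_on UNIV g')"

definition L1_loc :: "('a::euclidean_space \<Rightarrow> real) set" where
  "L1_loc = {u. \<forall>C. compact C \<longrightarrow> set_integrable lebesgue C u}"

(* Elements of the weighted Lebesgue space are represented by functions, and equality in the
   space is equality almost everywhere with respect to Lebesgue measure. For a positive weight
   this is the same as Lp_norm p rho (u - v) = 0. *)

definition Lp_space :: "real \<Rightarrow> ('a::euclidean_space \<Rightarrow> real) \<Rightarrow> ('a \<Rightarrow> real) set" where
  "Lp_space p \<rho> = {u \<in> L1_loc. integrable lebesgue (\<lambda>x. \<bar>u x\<bar> powr p * \<rho> x)}"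

definition Lp_norm :: "real \<Rightarrow> ('a::euclidean_space \<Rightarrow> real) \<Rightarrow> ('a \<Rightarrow> real) \<Rightarrow> real" where
  "Lp_norm p \<rho> u = (\<integral>x. \<bar>u x\<bar> powr p * \<rho> x \<partial>lebesgue) powr (1 / p)"

(* u is continuous from [0,oo) to the weighted space; values at negative times are irrelevant. *)

definition Lp_continuous_curve ::
    "real \<Rightarrow> ('a::euclidean_space \<Rightarrow> real) \<Rightarrow> (real \<Rightarrow> 'a \<Rightarrow> real) \<Rightarrow> bool" where
  "Lp_continuous_curve p \<rho> u \<longleftrightarrow>
     (\<forall>t\<ge>0. u t \<in> Lp_space p \<rho> \<and>
        ((\<lambda>s. Lp_norm p \<rho> (\<lambda>x. u s x - u t x)) \<longlongrightarrow> 0) (at t within {0..}))"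

definition Lp_has_derivative_curve ::
    "real \<Rightarrow> ('a::euclidean_space \<Rightarrow> real) \<Rightarrow> (real \<Rightarrow> 'a \<Rightarrow> real) \<Rightarrow> (real \<Rightarrow> 'a \<Rightarrow> real) \<Rightarrow> bool" where
  "Lp_has_derivative_curve p \<rho> u u' \<longleftrightarrow>
     (\<forall>t\<ge>0. u t \<in> Lp_space p \<rho> \<and> u' t \<in> Lp_space p \<rho> \<and>
        ((\<lambda>s. Lp_norm p \<rho> (\<lambda>x. (u s x - u t x) / (s - t) - u' t x)) \<longlongrightarrow> 0) (at t within {0..}))"

(* u is in C^1([0,oo); L^p(rho)), its derivative equals F (u t) in L^p(rho) for every t >= 0,
   and u 0 = u0 in L^p(rho). *)

definition Lp_ode_solution ::
    "real \<Rightarrow> ('a::euclidean_space \<Rightarrow> real) \<Rightarrow> (('a \<Rightarrow> real) \<Rightarrow> ('a \<Rightarrow> real)) \<Rightarrow>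
     ('a \<Rightarrow> real) \<Rightarrow> (real \<Rightarrow> 'a \<Rightarrow> real) \<Rightarrow> bool" where
  "Lp_ode_solution p \<rho> F u\<^sub>0 u \<longleftrightarrow>
     (\<exists>u'. Lp_has_derivative_curve p \<rho> u u' \<and> Lp_continuous_curve p \<rho> u' \<and>
        (\<forall>t\<ge>0. AE x in lebesgue. u' t x = F (u t) x)) \<and>
     (AE x in lebesgue. u 0 x = u\<^sub>0 x)"

(* S u0 is a representative of the unique solution with initial value u0. *)

definition Lp_globally_well_posed ::
    "real \<Rightarrow> ('a::euclidean_space \<Rightarrow> real) \<Rightarrow> (('a \<Rightarrow> real) \<Rightarrow> ('a \<Rightarrow> real)) \<Rightarrow> bool" where
  "Lp_globally_well_posed p \<rho> F \<longleftrightarrow>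
     (\<exists>S.
        (\<forall>u\<^sub>0\<in>Lp_space p \<rho>.
           Lp_ode_solution p \<rho> F u\<^sub>0 (S u\<^sub>0) \<and>
           (\<forall>w. Lp_ode_solution p \<rho> F u\<^sub>0 w \<longrightarrow>
              (\<forall>t\<ge>0. AE x in lebesgue. w t x = S u\<^sub>0 t x))) \<and>
        (\<forall>t\<ge>0. \<forall>u\<^sub>0\<in>Lp_space p \<rho>. \<forall>\<epsilon>>0. \<exists>\<delta>>0. \<forall>v\<^sub>0\<in>Lp_space p \<rho>.
           Lp_norm p \<rho> (\<lambda>x. v\<^sub>0 x - u\<^sub>0 x) < \<delta> \<longrightarrow>
           Lp_norm p \<rho> (\<lambda>x. S v\<^sub>0 t x - S u\<^sub>0 t x) < \<epsilon>))"

definition conv :: "('a::euclidean_space \<Rightarrow> real) \<Rightarrow> ('a \<Rightarrow> real) \<Rightarrow> 'a \<Rightarrow> real" where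
  "conv J v x = (\<integral>y. J (x - y) * v y \<partial>lebesgue)"

definition neural_field_rhs ::
    "('a::euclidean_space \<Rightarrow> real) \<Rightarrow> (real \<Rightarrow> real) \<Rightarrow> real \<Rightarrow> ('a \<Rightarrow> real) \<Rightarrow> 'a \<Rightarrow> real" where
  "neural_field_rhs J f h u x = - u x + conv J (f \<circ> u) x + h"

end

theory Submission
  imports Defs
begin

text \<open>
  Write a solution as \<open>u(t) = a(t) u\<^sub>0 + W v(t)\<close>, with a scalar \<open>a\<close>, a bounded continuous
  function \<open>v(t)\<close> and a fixed continuous weight \<open>W\<close>. The equation holds when \<open>a' = - a\<close> and
  \<open>v' = - v + (h + J * f(a u\<^sub>0 + W v)) / W\<close>. If \<open>W \<ge> 1 + J * \<bar>u\<^sub>0\<bar>\<close> and \<open>J * W \<le> \<Lambda> W\<close>, then this is an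
  ordinary differential equation for \<open>(a, v)\<close> with a globally Lipschitz right-hand side in a Banach
  space with the supremum norm, so no integration of curves in the weighted Lebesgue space is
  needed. Such a \<open>W\<close> is a resolvent series of the convolution with \<open>J\<close>; it belongs to the weighted
  space because the doubling property of \<open>\<rho>\<close> makes that convolution bounded there. Uniqueness and
  continuous dependence follow from Gronwall's inequality for the weighted norm of a difference.
\<close>

section \<open>Ordinary differential equations in Banach spaces\<close>

text \<open>The weighted space is a set of representatives with equality almost everywhere, not a
  Banach type, so an abstract existence theorem does not apply to it directly. The remedy uses
  smoothing: convolution with J produces continuous functions, and only the term -u transports the
  roughness of the initial value, which therefore survives as exp (- t) times
  \<open>u\<^sub>0\<close>. The remainder is continuous but in general unbounded, and division by W
  makes it bounded. The two conditions on W serve different terms: its lower bound absorbs h, f 0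
  and the contribution of \<open>u\<^sub>0\<close> to the nonlinear term, while J * W \<le>
  \<Lambda> W absorbs the contribution of W v, which is again unbounded. Since W depends on
  \<open>u\<^sub>0\<close> and a competing solution need not have the special form, the reduction
  cannot compare solutions with each other; this is why all comparisons take place in the weighted
  norm itself.\<close>

lemma picard_weighted_integral_bound:
  fixes y :: "real \<Rightarrow> 'a::banach"
  assumes cont: "continuous_on {0..t} y" and \<mu>: "0 < \<mu>" and t: "0 \<le> t" and C: "0 \<le> C"
    and bound: "\<And>s. 0 \<le> s \<Longrightarrow> s \<le> t \<Longrightarrow> norm (y s) \<le> C * exp (\<mu> * s)"
  shows "norm (exp (- \<mu> * t) *\<^sub>R integral {0..t} y) \<le> C / \<mu>"
proof -
  have I: "((\<lambda>s. C * exp (\<mu> * s)) has_integral (C / \<mu> * exp (\<mu> * t) - C / \<mu> * exp (\<mu> * 0))) {0..t}"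
    by (rule fundamental_theorem_of_calculus)
      (use \<mu> t in \<open>auto intro!: derivative_eq_intros simp: has_real_derivative_iff_has_vector_derivative[symmetric]\<close>)
  have "norm (integral {0..t} y) \<le> integral {0..t} (\<lambda>s. C * exp (\<mu> * s))"
    using cont bound
    by (intro integral_norm_bound_integral integrable_continuous_interval) (auto intro!: continuous_intros)
  also have "\<dots> = C / \<mu> * exp (\<mu> * t) - C / \<mu>"
    using integral_unique[OF I] by simp
  also have "\<dots> \<le> C / \<mu> * exp (\<mu> * t)"
    using C \<mu> by simp
  finally have "exp (- \<mu> * t) * norm (integral {0..t} y) \<le> exp (- \<mu> * t) * (C / \<mu> * exp (\<mu> * t))"
    by (intro mult_left_mono) auto
  also have "\<dots> = C / \<mu>"
    by (simp add: exp_minus field_simps)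
  finally show ?thesis by simp
qed

lemma global_solution_lipschitz_ode:
  fixes G :: "'a::banach \<Rightarrow> 'a"
  assumes lip: "\<And>x y. norm (G x - G y) \<le> L * norm (x - y)" and L: "0 \<le> L"
  obtains v where "v 0 = x0"
    and "\<And>t. 0 \<le> t \<Longrightarrow> (v has_vector_derivative G (v t)) (at t within {0..})"
proof -
  \<comment> \<open>The fixed point is the rescaled solution \<open>exp (- \<mu> * t) *\<^sub>R v t\<close>: for \<open>\<mu> > 2 * L\<close> the Picard map
    is a contraction in the supremum norm on the whole half-line, so no local solutions are glued.\<close>
  define \<mu> where "\<mu> = 2 * L + 1"
  have \<mu>: "0 < \<mu>" using L by (simp add: \<mu>_def)
  have G_cont: "continuous_on UNIV G"
  proof (rule lipschitz_on_continuous_on)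
    show "L-lipschitz_on UNIV G"
      using lip L by (intro lipschitz_onI) (auto simp: dist_norm)
  qed
  have int_cont: "continuous_on {0..} (\<lambda>s. G (exp (\<mu> * s) *\<^sub>R apply_bcontfun z s))" for z :: "real \<Rightarrow>\<^sub>C 'a"
    by (intro continuous_on_compose2[OF G_cont] continuous_intros) auto
  define y where "y z s = G (exp (\<mu> * s) *\<^sub>R apply_bcontfun z s)" for z :: "real \<Rightarrow>\<^sub>C 'a" and s
  have y_cont: "continuous_on {0..t} (y z)" for z t
    unfolding y_def by (rule continuous_on_subset[OF int_cont]) auto
  \<comment> \<open>Elements of \<open>bcontfun\<close> live on the whole line;
    \<open>max 0 t\<close> extends the Picard image to negative times by its value at 0.\<close>
  define P where "P z t = exp (- \<mu> * max 0 t) *\<^sub>R (x0 + integral {0..max 0 t} (y z))" for z t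
  have prim_deriv: "((\<lambda>t. integral {0..t} (y z)) has_vector_derivative y z t) (at t within {0..})"
    if "0 \<le> t" for z t
  proof -
    \<comment> \<open>The interval reaches one unit past t, so near t it agrees with the half-line
      and the two filters coincide.\<close>
    have "((\<lambda>t. integral {0..t} (y z)) has_vector_derivative y z t) (at t within {0..t+1})"
      using that by (intro integral_has_vector_derivative y_cont) auto
    moreover have "at t within {0..t+1} = at t within {0..}"
      by (rule at_within_nhd[of _ "{..<t+1}"]) (use that in auto)
    ultimately show ?thesis by simp
  qed
  have prim_cont: "continuous_on {0..} (\<lambda>t. integral {0..t} (y z))" for z
    unfolding continuous_on_eq_continuous_within
    using prim_deriv by (blast intro: has_vector_derivative_continuous)
  have P_cont: "continuous_on UNIV (P z)" for z
    unfolding P_def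
    by (intro continuous_intros continuous_on_compose2[OF prim_cont]) auto
  have y_bound: "norm (y z s) \<le> (norm (G 0) + L * norm z) * exp (\<mu> * s)" if "0 \<le> s" for z s
  proof -
    have "norm (y z s) \<le> norm (G 0) + L * norm (exp (\<mu> * s) *\<^sub>R apply_bcontfun z s)"
      using lip[of "exp (\<mu> * s) *\<^sub>R apply_bcontfun z s" 0]
        norm_triangle_sub[of "y z s" "G 0"] unfolding y_def by simp
    also have "\<dots> \<le> norm (G 0) * exp (\<mu> * s) + L * (exp (\<mu> * s) * norm z)"
    proof (intro add_mono mult_left_mono L)
      show "norm (G 0) \<le> norm (G 0) * exp (\<mu> * s)"
        using \<mu> that mult_left_mono[of 1 "exp (\<mu> * s)" "norm (G 0)"] by simp
      show "norm (exp (\<mu> * s) *\<^sub>R apply_bcontfun z s) \<le> exp (\<mu> * s) * norm z"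
        using norm_bounded[of z s] by simp
    qed
    finally show ?thesis by (simp add: algebra_simps)
  qed
  have P_bcont: "P z \<in> bcontfun" for z
  proof (rule bcontfun_normI[OF P_cont])
    fix t :: real
    let ?t = "max 0 t"
    have "norm (P z t) \<le> norm (exp (- \<mu> * ?t) *\<^sub>R x0) + norm (exp (- \<mu> * ?t) *\<^sub>R integral {0..?t} (y z))"
      unfolding P_def scaleR_add_right by (rule norm_triangle_ineq)
    also have "\<dots> \<le> norm x0 + (norm (G 0) + L * norm z) / \<mu>"
    proof (intro add_mono)
      show "norm (exp (- \<mu> * ?t) *\<^sub>R x0) \<le> norm x0"
        using \<mu> by (simp add: mult_left_le_one_le)
      show "norm (exp (- \<mu> * ?t) *\<^sub>R integral {0..?t} (y z)) \<le> (norm (G 0) + L * norm z) / \<mu>"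
        using y_bound L \<mu> by (intro picard_weighted_integral_bound y_cont) auto
    qed
    finally show "norm (P z t) \<le> norm x0 + (norm (G 0) + L * norm z) / \<mu>" .
  qed
  define Q where "Q z = Bcontfun (P z)" for z
  have Q_apply: "apply_bcontfun (Q z) t = P z t" for z t
    unfolding Q_def using P_bcont by (simp add: Bcontfun_inverse)
  have contr: "dist (Q z) (Q w) \<le> 1/2 * dist z w" for z w
  proof (rule dist_bound)
    fix t :: real
    let ?t = "max 0 t"
    have "P z t - P w t = exp (- \<mu> * ?t) *\<^sub>R (integral {0..?t} (y z) - integral {0..?t} (y w))"
      unfolding P_def by (simp add: algebra_simps)
    also have "\<dots> = exp (- \<mu> * ?t) *\<^sub>R integral {0..?t} (\<lambda>s. y z s - y w s)"
      by (subst integral_diff) (auto intro!: integrable_continuous_interval y_cont)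
    finally have "norm (P z t - P w t) \<le> (L * norm (z - w)) / \<mu>"
    proof (elim ssubst, intro picard_weighted_integral_bound)
      fix s assume s: "0 \<le> s" "s \<le> ?t"
      have "norm (y z s - y w s) \<le> L * norm (exp (\<mu> * s) *\<^sub>R (apply_bcontfun z s - apply_bcontfun w s))"
        using lip unfolding y_def scaleR_diff_right by blast
      also have "\<dots> \<le> L * (exp (\<mu> * s) * norm (z - w))"
        using L norm_bounded[of "z - w" s] by (intro mult_left_mono) auto
      finally show "norm (y z s - y w s) \<le> L * norm (z - w) * exp (\<mu> * s)"
        by (simp add: algebra_simps)
    qed (use L \<mu> in \<open>auto intro!: continuous_intros y_cont\<close>)
    also have "\<dots> = (L / \<mu>) * norm (z - w)"
      by simp
    also have "\<dots> \<le> 1/2 * norm (z - w)"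
      using L by (intro mult_right_mono) (auto simp: \<mu>_def divide_simps)
    finally show "dist (apply_bcontfun (Q z) t) (apply_bcontfun (Q w) t) \<le> 1/2 * dist z w"
      unfolding Q_apply dist_norm .
  qed
  obtain z where z: "Q z = z"
    using banach_fix_type[of "1/2" Q] contr by auto
  define v where "v t = exp (\<mu> * t) *\<^sub>R apply_bcontfun z t" for t
  have v_eq: "v t = x0 + integral {0..t} (y z)" if "0 \<le> t" for t
  proof -
    have "apply_bcontfun z t = exp (- \<mu> * t) *\<^sub>R (x0 + integral {0..t} (y z))"
      using Q_apply[of z t] that unfolding z P_def by (simp add: max_def)
    then show ?thesis unfolding v_def
      by (simp flip: exp_add)
  qed
  show ?thesis
  proof (rule that)
    show "v 0 = x0" using v_eq[of 0] by simp
    fix t :: real assume t: "0 \<le> t"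
    have "((\<lambda>t. x0 + integral {0..t} (y z)) has_vector_derivative 0 + y z t) (at t within {0..})"
      by (intro has_vector_derivative_add prim_deriv t) auto
    then have "(v has_vector_derivative y z t) (at t within {0..})"
      using t v_eq by (auto elim!: has_vector_derivative_transform[rotated 2])
    then show "(v has_vector_derivative G (v t)) (at t within {0..})"
      unfolding y_def v_def .
  qed
qed

text \<open>The norm of a difference of two curves may fail to be differentiable, so only a local
  bound on its increments is assumed. The proof compares D with a strict supersolution
  \<open>\<psi>\<close>, whose rate and initial value both exceed the desired ones by e: D cannot
  cross it, and e tends to 0 at the end.\<close>

lemma gronwall_dini:
  fixes D :: "real \<Rightarrow> real"
  assumes L: "0 \<le> L" and D0: "\<And>t. 0 \<le> t \<Longrightarrow> 0 \<le> D t"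
    and step: "\<And>t \<epsilon>. 0 \<le> t \<Longrightarrow> 0 < \<epsilon> \<Longrightarrow>
      \<forall>\<^sub>F s in at t within {0..}. \<bar>D s - D t\<bar> \<le> \<bar>s - t\<bar> * (L * D t + \<epsilon>)"
    and t: "0 \<le> t"
  shows "D t \<le> exp (L * t) * D 0"
proof -
  have cont: "continuous_on {0..} D"
    unfolding continuous_on_def
  proof
    fix t :: real assume "t \<in> {0..}"
    then have t: "0 \<le> t" by simp
    have "((\<lambda>s. D s - D t) \<longlongrightarrow> 0) (at t within {0..})"
    proof (rule Lim_null_comparison)
      show "\<forall>\<^sub>F s in at t within {0..}. norm (D s - D t) \<le> \<bar>s - t\<bar> * (L * D t + 1)"
        using step[OF t, of 1] by simp
      have "((\<lambda>s. \<bar>s - t\<bar> * (L * D t + 1)) \<longlongrightarrow> \<bar>t - t\<bar> * (L * D t + 1)) (at t within {0..})"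
        by (intro tendsto_intros)
      then show "((\<lambda>s. \<bar>s - t\<bar> * (L * D t + 1)) \<longlongrightarrow> 0) (at t within {0..})" by simp
    qed
    then show "(D \<longlongrightarrow> D t) (at t within {0..})"
      by (simp add: Lim_null[symmetric])
  qed
  have main: "D t \<le> exp ((L + e) * t) * (D 0 + e)" if e: "0 < e" for e
  proof (rule ccontr)
    define \<psi> where "\<psi> s = exp ((L + e) * s) * (D 0 + e)" for s
    assume "\<not> ?thesis"
    then have bad: "\<psi> t < D t" by (simp add: \<psi>_def)
    define A where "A = {s. 0 \<le> s \<and> \<psi> s < D s}"
    have Ane: "t \<in> A" using bad t by (simp add: A_def)
    have Abdd: "bdd_below A" by (auto simp: A_def intro: bdd_belowI[of _ 0])
    define s0 where "s0 = Inf A"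
    have s0: "0 \<le> s0" unfolding s0_def by (rule cInf_greatest) (use Ane in \<open>auto simp: A_def\<close>)
    have \<psi>_pos: "0 < \<psi> s" for s
      using D0[of 0] e by (simp add: \<psi>_def)
    have \<psi>_cont: "continuous_on S \<psi>" for S
      unfolding \<psi>_def by (intro continuous_intros)
    have le: "D s0 \<le> \<psi> s0"
    proof (cases "s0 = 0")
      case True then show ?thesis using e by (simp add: \<psi>_def)
    next
      case False
      have "\<not> (\<psi> s < D s)" if "0 \<le> s" "s < s0" for s
        using that cInf_lower[OF _ Abdd, of s] unfolding s0_def A_def by force
      then have *: "D s \<le> \<psi> s" if "s \<in> {0..<s0}" for s
        using that by force
      have "D s0 - \<psi> s0 \<le> 0"
      proof (rule tendsto_upperbound)
        have "continuous_on {0..s0} (\<lambda>s. D s - \<psi> s)"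
          by (intro continuous_intros \<psi>_cont continuous_on_subset[OF cont]) auto
        then show "((\<lambda>s. D s - \<psi> s) \<longlongrightarrow> D s0 - \<psi> s0) (at_left s0)"
          using False s0 by (intro continuous_on_Icc_at_leftD) auto
        show "\<forall>\<^sub>F s in at_left s0. D s - \<psi> s \<le> 0"
          using False s0 * by (auto simp: eventually_at_left_field intro!: exI[of _ 0])
      qed auto
      then show ?thesis by simp
    qed
    \<comment> \<open>With the tolerance e * \<psi> s0 and D s0 \<le> \<psi> s0, the bound on the
      slope of D becomes (L + e) * \<psi> s0, the slope of \<open>\<psi>\<close> at s0. Then 1 + x
      \<le> exp x keeps D below \<open>\<psi>\<close> for a while beyond s0, although s0 is the
      infimum of the bad set.\<close>
    have "\<forall>\<^sub>F s in at s0 within {0..}. \<bar>D s - D s0\<bar> \<le> \<bar>s - s0\<bar> * (L * D s0 + e * \<psi> s0)"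
      using step[OF s0] e \<psi>_pos by simp
    then obtain d where d: "0 < d"
      and near: "\<And>s. 0 \<le> s \<Longrightarrow> s \<noteq> s0 \<Longrightarrow> dist s s0 < d \<Longrightarrow>
          \<bar>D s - D s0\<bar> \<le> \<bar>s - s0\<bar> * (L * D s0 + e * \<psi> s0)"
      unfolding eventually_at by auto
    have good: "D s \<le> \<psi> s" if s: "s0 \<le> s" "s < s0 + d" for s
    proof (cases "s = s0")
      case False
      then have "\<bar>D s - D s0\<bar> \<le> \<bar>s - s0\<bar> * (L * D s0 + e * \<psi> s0)"
        using s s0 by (intro near) (auto simp: dist_real_def)
      then have "D s \<le> D s0 + (s - s0) * (L * D s0 + e * \<psi> s0)"
        using s by auto
      also have "\<dots> \<le> \<psi> s0 + (s - s0) * (L * \<psi> s0 + e * \<psi> s0)"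
        using s le L by (intro add_mono mult_left_mono order_refl) auto
      also have "\<dots> = \<psi> s0 * (1 + (L + e) * (s - s0))"
        by (simp add: algebra_simps)
      also have "\<dots> \<le> \<psi> s0 * exp ((L + e) * (s - s0))"
        using \<psi>_pos[of s0] exp_ge_add_one_self by (intro mult_left_mono) auto
      also have "\<dots> = \<psi> s"
        unfolding \<psi>_def by (simp add: algebra_simps flip: exp_add)
      finally show ?thesis .
    qed (use le in simp)
    obtain s where "s \<in> A" "s < s0 + d"
      using cInf_lessD[of A "s0 + d"] Ane d unfolding s0_def by auto
    moreover have "s0 \<le> s" unfolding s0_def by (rule cInf_lower[OF \<open>s \<in> A\<close> Abdd])
    ultimately show False using good[of s] by (simp add: A_def)
  qed
  have "D t \<le> exp ((L + 0) * t) * (D 0 + 0)"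
  proof (rule tendsto_lowerbound)
    show "((\<lambda>e. exp ((L + e) * t) * (D 0 + e)) \<longlongrightarrow> exp ((L + 0) * t) * (D 0 + 0)) (at_right 0)"
      by (intro tendsto_intros)
    show "\<forall>\<^sub>F e in at_right 0. D t \<le> exp ((L + e) * t) * (D 0 + e)"
      using main by (auto simp: eventually_at_filter)
  qed auto
  then show ?thesis by simp
qed

section \<open>Lebesgue spaces with a doubling weight\<close>

text \<open>Jensen's inequality is used below in this form, because averaging a supporting line over
  values with mean m removes the linear term. The endpoint t = 0 is checked directly.\<close>

lemma powr_above_tangent:
  fixes p m t :: real
  assumes "1 \<le> p" "0 < m" "0 \<le> t"
  shows "m powr p + p * m powr (p - 1) * (t - m) \<le> t powr p"
proof (cases "t = 0")
  case True
  have "m powr p = m powr (p - 1) * m"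
    using assms by (simp add: powr_diff)
  moreover have "1 * m powr p \<le> p * m powr p"
    using assms by (intro mult_right_mono) auto
  ultimately show ?thesis
    using True by (simp add: algebra_simps)
next
  case False
  have "t powr p - m powr p \<ge> (p * m powr (p - 1)) * (t - m)"
    using assms False
    by (intro convex_on_imp_above_tangent[OF powr_convex[of p]])
      (auto intro!: derivative_eq_intros simp: interior_open)
  then show ?thesis by simp
qed

text \<open>The two tangent inequalities at the mean m are averaged and their first-order terms
  cancel; for m = 0 the left-hand side is 0.\<close>

lemma powr_convex_combination:
  fixes p x y \<theta> :: real
  assumes p: "1 \<le> p" and xy: "0 \<le> x" "0 \<le> y" and \<theta>: "0 \<le> \<theta>" "\<theta> \<le> 1"
  shows "((1 - \<theta>) * x + \<theta> * y) powr p \<le> (1 - \<theta>) * x powr p + \<theta> * y powr p"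
proof (cases "(1 - \<theta>) * x + \<theta> * y = 0")
  case False
  define m where "m = (1 - \<theta>) * x + \<theta> * y"
  have m: "0 < m" using False xy \<theta> unfolding m_def by (simp add: order_less_le)
  have "m powr p = (1 - \<theta>) * (m powr p + p * m powr (p - 1) * (x - m))
      + \<theta> * (m powr p + p * m powr (p - 1) * (y - m))"
    by (simp add: m_def algebra_simps)
  also have "\<dots> \<le> (1 - \<theta>) * x powr p + \<theta> * y powr p"
    using \<theta> xy m p by (intro add_mono mult_left_mono powr_above_tangent) auto
  finally show ?thesis by (simp add: m_def)
qed (use assms in simp)

lemma powr_add_le:
  fixes p x y :: real
  assumes "1 \<le> p" "0 \<le> x" "0 \<le> y"
  shows "(x + y) powr p \<le> 2 powr (p - 1) * (x powr p + y powr p)"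
proof -
  have "(x + y) powr p = 2 powr p * ((1 - 1/2) * x + 1/2 * y) powr p"
    using assms by (subst powr_mult[symmetric]) auto
  also have "\<dots> \<le> 2 powr p * ((1 - 1/2) * x powr p + 1/2 * y powr p)"
    using assms by (intro mult_left_mono powr_convex_combination) auto
  also have "\<dots> = 2 powr (p - 1) * (x powr p + y powr p)"
    by (simp add: powr_diff field_simps)
  finally show ?thesis .
qed

section \<open>Local integrability\<close>

lemma L1_loc_measurable:
  assumes "u \<in> L1_loc"
  shows "u \<in> borel_measurable lebesgue"
proof (rule borel_measurable_LIMSEQ_real)
  fix n :: nat
  show "(\<lambda>x. indicator (cball 0 (real n)) x *\<^sub>R u x) \<in> borel_measurable lebesgue"
    by (rule borel_measurable_integrable)
      (use assms in \<open>simp add: L1_loc_def set_integrable_def\<close>)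
next
  fix x :: 'a
  have "\<forall>\<^sub>F n in sequentially. u x = indicator (cball 0 (real n)) x *\<^sub>R u x"
    using eventually_ge_at_top[of "nat \<lceil>norm x\<rceil>"]
    by eventually_elim (auto simp: indicator_def)
  then show "(\<lambda>n. indicator (cball 0 (real n)) x *\<^sub>R u x) \<longlonglongrightarrow> u x"
    by (rule Lim_transform_eventually[OF tendsto_const])
qed

text \<open>A finite cover reduces compact sets to balls of radius 1, the scale at which the
  doubling condition compares values of \<rho>.\<close>

lemma L1_locI_unit_balls:
  assumes "\<And>x. set_integrable lebesgue (cball x 1) u"
  shows "u \<in> L1_loc"
  unfolding L1_loc_def
proof (safe)
  fix C :: "'a set" assume C: "compact C"
  obtain I where I: "I \<subseteq> C" "finite I" "C \<subseteq> (\<Union>x\<in>I. ball x 1)"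
    by (rule compactE_image[OF C, of C "\<lambda>x. ball x 1"]) auto
  have "set_integrable lebesgue (\<Union>x\<in>I. cball x 1) u"
    using I(2) assms by (rule set_integrable_UN) simp
  then show "set_integrable lebesgue C u"
  proof (rule set_integrable_subset)
    show "C \<in> sets lebesgue" by (rule fmeasurableD[OF lmeasurable_compact[OF C]])
    show "C \<subseteq> (\<Union>x\<in>I. cball x 1)" 
      using I(3) by (rule order_trans) (intro UN_mono order_refl ball_subset_cball)
  qed
qed

section \<open>The weighted Lebesgue space and its norm\<close>

locale doubling_weight =
  fixes p K :: real and \<rho> :: "'a::euclidean_space \<Rightarrow> real"
  assumes p: "1 < p"
    and rho_integrable: "integrable lebesgue \<rho>"
    and rho_pos: "\<And>x. 0 < \<rho> x"
    and K_pos: "0 < K"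
    and rho_doubling: "\<And>x y. norm (x - y) \<le> 1 \<Longrightarrow> \<rho> x \<le> K * \<rho> y"
begin

lemma rho_measurable [measurable]: "\<rho> \<in> borel_measurable lebesgue"
  using rho_integrable by auto

text \<open>Positivity alone does not keep \<rho> away from 0 on a ball, but doubling gives \<rho> y
  \<ge> \<rho> x / K there. Together with \<bar>u\<bar> \<le> 1 + \<bar>u\<bar>^p this yields an
  integrable dominating function.\<close>

lemma unit_ball_integrable:
  assumes [measurable]: "u \<in> borel_measurable lebesgue"
    and int: "integrable lebesgue (\<lambda>x. \<bar>u x\<bar> powr p * \<rho> x)"
  shows "set_integrable lebesgue (cball x 1) u"
  unfolding set_integrable_def
proof (rule Bochner_Integration.integrable_bound)
  show "integrable lebesgue (\<lambda>y. indicator (cball x 1) y + K / \<rho> x * (\<bar>u y\<bar> powr p * \<rho> y))"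
  proof (intro Bochner_Integration.integrable_add integrable_mult_right int)
    show "integrable lebesgue (indicator (cball x 1) :: 'a \<Rightarrow> real)"
      using emeasure_lborel_cball_finite[of x 1]
      by (intro integrable_real_indicator) (simp_all del: infinity_ennreal_def)
  qed
  show "(\<lambda>y. indicator (cball x 1) y *\<^sub>R u y) \<in> borel_measurable lebesgue"
    using assms(1) by (intro borel_measurable_scaleR borel_measurable_indicator) simp_all
  have "\<bar>u y\<bar> \<le> 1 + K / \<rho> x * (\<bar>u y\<bar> powr p * \<rho> y)" if y: "norm (x - y) \<le> 1" for y
  proof -
    have "\<bar>u y\<bar> \<le> 1 + \<bar>u y\<bar> powr p"
    proof (cases "\<bar>u y\<bar> \<le> 1")
      case False
      then have "\<bar>u y\<bar> powr 1 \<le> \<bar>u y\<bar> powr p" using p by (intro powr_mono) auto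
      then show ?thesis using False by simp
    qed (simp add: add_increasing2)
    also have "\<bar>u y\<bar> powr p \<le> K / \<rho> x * (\<bar>u y\<bar> powr p * \<rho> y)"
    proof -
      have "1 * \<bar>u y\<bar> powr p \<le> (K * \<rho> y / \<rho> x) * \<bar>u y\<bar> powr p"
        using rho_doubling[OF y] rho_pos[of x] by (intro mult_right_mono) auto
      then show ?thesis by (simp add: algebra_simps)
    qed
    finally show ?thesis by (simp add: algebra_simps)
  qed
  then show "AE y in lebesgue. norm (indicator (cball x 1) y *\<^sub>R u y)
      \<le> norm (indicator (cball x 1) y + K / \<rho> x * (\<bar>u y\<bar> powr p * \<rho> y))"
    using rho_pos K_pos
    by (intro AE_I2) (auto simp: indicator_def dist_norm less_imp_le)
qed

text \<open>Local integrability comes for free by \<open>unit_ball_integrable\<close>, so membership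
  proofs below only check measurability and the weighted integral.\<close>

lemma Lp_space_iff:
  "u \<in> Lp_space p \<rho> \<longleftrightarrow>
    u \<in> borel_measurable lebesgue \<and> integrable lebesgue (\<lambda>x. \<bar>u x\<bar> powr p * \<rho> x)"
  unfolding Lp_space_def
  using L1_loc_measurable L1_locI_unit_balls unit_ball_integrable by blast

lemma Lp_measurable: "u \<in> Lp_space p \<rho> \<Longrightarrow> u \<in> borel_measurable lebesgue"
  by (simp add: Lp_space_iff)

lemma Lp_integrable: "u \<in> Lp_space p \<rho> \<Longrightarrow> integrable lebesgue (\<lambda>x. \<bar>u x\<bar> powr p * \<rho> x)"
  by (simp add: Lp_space_iff)

lemma Lp_unit_ball_integrable:
  "u \<in> Lp_space p \<rho> \<Longrightarrow> set_integrable lebesgue (cball x 1) u"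
  by (simp add: Lp_space_iff unit_ball_integrable)

lemma Lp_bound:
  assumes [measurable]: "v \<in> borel_measurable lebesgue" and u: "u \<in> Lp_space p \<rho>"
    and le: "\<And>x. \<bar>v x\<bar> \<le> \<bar>u x\<bar>"
  shows "v \<in> Lp_space p \<rho>" "Lp_norm p \<rho> v \<le> Lp_norm p \<rho> u"
proof -
  have le': "\<bar>v x\<bar> powr p * \<rho> x \<le> \<bar>u x\<bar> powr p * \<rho> x" for x
    using le p rho_pos[of x] by (intro mult_right_mono powr_mono2) auto
  have int: "integrable lebesgue (\<lambda>x. \<bar>v x\<bar> powr p * \<rho> x)"
    using le' rho_pos
    by (intro Bochner_Integration.integrable_bound[OF Lp_integrable[OF u]])
      (auto simp: abs_mult abs_of_pos intro!: borel_measurable_times)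
  then show "v \<in> Lp_space p \<rho>" by (simp add: Lp_space_iff)
  show "Lp_norm p \<rho> v \<le> Lp_norm p \<rho> u"
    unfolding Lp_norm_def using p rho_pos le' int Lp_integrable[OF u]
    by (intro powr_mono2 integral_mono integral_nonneg_AE) (auto simp: less_imp_le)
qed

lemma Lp_cmult:
  assumes "u \<in> Lp_space p \<rho>"
  shows "(\<lambda>x. c * u x) \<in> Lp_space p \<rho>" "Lp_norm p \<rho> (\<lambda>x. c * u x) = \<bar>c\<bar> * Lp_norm p \<rho> u"
proof -
  have eq: "\<bar>c * u x\<bar> powr p * \<rho> x = \<bar>c\<bar> powr p * (\<bar>u x\<bar> powr p * \<rho> x)" for x
    by (simp add: abs_mult powr_mult)
  show "(\<lambda>x. c * u x) \<in> Lp_space p \<rho>"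
    unfolding Lp_space_iff eq using assms
    by (simp add: Lp_space_iff borel_measurable_times[OF borel_measurable_const])
  show "Lp_norm p \<rho> (\<lambda>x. c * u x) = \<bar>c\<bar> * Lp_norm p \<rho> u"
    unfolding Lp_norm_def eq using p rho_pos
    by (simp add: powr_mult powr_powr integral_nonneg_AE less_imp_le)
qed

lemma Lp_const: "(\<lambda>x. c) \<in> Lp_space p \<rho>"
  using rho_integrable by (simp add: Lp_space_iff)

lemma Lp_add:
  assumes u: "u \<in> Lp_space p \<rho>" and v: "v \<in> Lp_space p \<rho>"
  shows "(\<lambda>x. u x + v x) \<in> Lp_space p \<rho>"
proof -
  note [measurable] = Lp_measurable[OF u] Lp_measurable[OF v]
  have le: "\<bar>u x + v x\<bar> powr p * \<rho> x
      \<le> 2 powr (p - 1) * (\<bar>u x\<bar> powr p * \<rho> x + \<bar>v x\<bar> powr p * \<rho> x)" for x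
  proof -
    have "\<bar>u x + v x\<bar> powr p \<le> (\<bar>u x\<bar> + \<bar>v x\<bar>) powr p"
      using p by (intro powr_mono2) auto
    also have "\<dots> \<le> 2 powr (p - 1) * (\<bar>u x\<bar> powr p + \<bar>v x\<bar> powr p)"
      using p by (intro powr_add_le) auto
    finally have "\<bar>u x + v x\<bar> powr p * \<rho> x \<le> 2 powr (p - 1) * (\<bar>u x\<bar> powr p + \<bar>v x\<bar> powr p) * \<rho> x"
      using rho_pos[of x] by (intro mult_right_mono) auto
    then show ?thesis by (simp add: algebra_simps)
  qed
  have "integrable lebesgue (\<lambda>x. \<bar>u x + v x\<bar> powr p * \<rho> x)"
  proof (rule Bochner_Integration.integrable_bound)
    show "integrable lebesgue (\<lambda>x. 2 powr (p - 1) * (\<bar>u x\<bar> powr p * \<rho> x + \<bar>v x\<bar> powr p * \<rho> x))"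
      using Lp_integrable[OF u] Lp_integrable[OF v] by simp
    show "(\<lambda>x. \<bar>u x + v x\<bar> powr p * \<rho> x) \<in> borel_measurable lebesgue" by measurable
    have "norm (\<bar>u x + v x\<bar> powr p * \<rho> x) = \<bar>u x + v x\<bar> powr p * \<rho> x" for x
      using rho_pos[of x] by simp
    then show "AE x in lebesgue. norm (\<bar>u x + v x\<bar> powr p * \<rho> x)
      \<le> norm (2 powr (p - 1) * (\<bar>u x\<bar> powr p * \<rho> x + \<bar>v x\<bar> powr p * \<rho> x))"
      using le by (intro AE_I2) (simp only: real_norm_def, rule order_trans[OF _ abs_ge_self], simp)
  qed
  then show ?thesis by (simp add: Lp_space_iff)
qed

lemma Lp_diff:
  assumes u: "u \<in> Lp_space p \<rho>" and v: "v \<in> Lp_space p \<rho>"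
  shows "(\<lambda>x. u x - v x) \<in> Lp_space p \<rho>"
  using Lp_add[OF u Lp_cmult(1)[OF v, of "-1"]] by simp

lemma Lp_abs:
  assumes u: "u \<in> Lp_space p \<rho>"
  shows "(\<lambda>x. \<bar>u x\<bar>) \<in> Lp_space p \<rho>"
  using u unfolding Lp_space_iff by (intro conjI borel_measurable_abs) auto

lemma Lp_norm_nonneg: "0 \<le> Lp_norm p \<rho> u"
  by (simp add: Lp_norm_def)

lemma Lp_norm_cong_AE:
  assumes "AE x in lebesgue. u x = v x" and "u \<in> borel_measurable lebesgue" "v \<in> borel_measurable lebesgue"
  shows "Lp_norm p \<rho> u = Lp_norm p \<rho> v"
proof -
  note [measurable] = assms(2,3)
  show ?thesis
    unfolding Lp_norm_def
    by (intro arg_cong[where f = "\<lambda>x. x powr _"] integral_cong_AE)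
      (measurable, use assms(1) in eventually_elim, simp)
qed

lemma Lp_norm_powr: "Lp_norm p \<rho> u powr p = (\<integral>x. \<bar>u x\<bar> powr p * \<rho> x \<partial>lebesgue)"
  using p rho_pos by (simp add: Lp_norm_def powr_powr integral_nonneg_AE less_imp_le)

lemma Lp_norm_eq_0D:
  assumes "u \<in> Lp_space p \<rho>" "Lp_norm p \<rho> u = 0"
  shows "AE x in lebesgue. u x = 0"
proof -
  have "(\<integral>x. \<bar>u x\<bar> powr p * \<rho> x \<partial>lebesgue) = 0"
    using Lp_norm_powr[of u] assms(2) by simp
  then have "AE x in lebesgue. \<bar>u x\<bar> powr p * \<rho> x = 0"
    using rho_pos by (subst (asm) integral_nonneg_eq_0_iff_AE[OF Lp_integrable[OF assms(1)]])
      (auto simp: less_imp_le)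
  then show ?thesis
    by eventually_elim (use rho_pos in \<open>auto simp: less_imp_neq[symmetric]\<close>)
qed

text \<open>Minkowski's inequality from convexity alone: \<bar>u\<bar> + \<bar>v\<bar> is a + b
  times the convex combination of \<bar>u\<bar> / a and \<bar>v\<bar> / b with weights a / (a + b)
  and b / (a + b), and these two functions have norm 1. Vanishing norms are split off first because
  of the divisions.\<close>

lemma Lp_norm_triangle:
  assumes u: "u \<in> Lp_space p \<rho>" and v: "v \<in> Lp_space p \<rho>"
  shows "Lp_norm p \<rho> (\<lambda>x. u x + v x) \<le> Lp_norm p \<rho> u + Lp_norm p \<rho> v"
proof -
  note [measurable] = Lp_measurable[OF u] Lp_measurable[OF v]
  define a b where "a = Lp_norm p \<rho> u" and "b = Lp_norm p \<rho> v"
  consider "a = 0" | "b = 0" | "0 < a" "0 < b"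
    using Lp_norm_nonneg[of u] Lp_norm_nonneg[of v] unfolding a_def b_def by linarith
  then show ?thesis
  proof cases
    case 1
    then have "AE x in lebesgue. u x = 0" using u by (auto simp: a_def intro: Lp_norm_eq_0D)
    then have "Lp_norm p \<rho> (\<lambda>x. u x + v x) = Lp_norm p \<rho> v"
      by (intro Lp_norm_cong_AE) auto
    then show ?thesis using Lp_norm_nonneg[of u] by simp
  next
    case 2
    then have "AE x in lebesgue. v x = 0" using v by (auto simp: b_def intro: Lp_norm_eq_0D)
    then have "Lp_norm p \<rho> (\<lambda>x. u x + v x) = Lp_norm p \<rho> u"
      by (intro Lp_norm_cong_AE) auto
    then show ?thesis using Lp_norm_nonneg[of v] by simp
  next
    case 3
    let ?\<theta> = "b / (a + b)"
    have \<theta>: "0 \<le> ?\<theta>" "?\<theta> \<le> 1" "1 - ?\<theta> = a / (a + b)"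
      using 3 by (auto simp: field_simps)
    let ?R = "\<lambda>x. (a + b) powr p * ((1 - ?\<theta>) * (\<bar>u x\<bar> powr p * \<rho> x / a powr p)
        + ?\<theta> * (\<bar>v x\<bar> powr p * \<rho> x / b powr p))"
    have le: "\<bar>u x + v x\<bar> powr p * \<rho> x \<le> ?R x" for x
    proof -
      have "\<bar>u x + v x\<bar> powr p \<le> (\<bar>u x\<bar> + \<bar>v x\<bar>) powr p"
        using p by (intro powr_mono2) auto
      also have "\<bar>u x\<bar> + \<bar>v x\<bar> = (a + b) * ((1 - ?\<theta>) * (\<bar>u x\<bar> / a) + ?\<theta> * (\<bar>v x\<bar> / b))"
        using 3 unfolding \<theta>(3) by (simp add: distrib_left)
      also have "\<dots> powr p = (a + b) powr p * ((1 - ?\<theta>) * (\<bar>u x\<bar> / a) + ?\<theta> * (\<bar>v x\<bar> / b)) powr p"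
        using 3 \<theta> by (intro powr_mult)
      also have "\<dots> \<le> (a + b) powr p * ((1 - ?\<theta>) * (\<bar>u x\<bar> / a) powr p + ?\<theta> * (\<bar>v x\<bar> / b) powr p)"
        using 3 \<theta> p by (intro mult_left_mono powr_convex_combination) auto
      finally have "\<bar>u x + v x\<bar> powr p * \<rho> x \<le> \<dots> * \<rho> x"
        using rho_pos[of x] by (intro mult_right_mono) auto
      also have "\<dots> = ?R x"
        using 3 by (simp add: powr_divide algebra_simps)
      finally show ?thesis .
    qed
    have "(\<integral>x. \<bar>u x + v x\<bar> powr p * \<rho> x \<partial>lebesgue) \<le> (\<integral>x. ?R x \<partial>lebesgue)"
      using Lp_integrable[OF u] Lp_integrable[OF v] Lp_integrable[OF Lp_add[OF u v]] le
      by (intro integral_mono) auto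
    also have "\<dots> = (a + b) powr p * ((1 - ?\<theta>) * (a powr p / a powr p) + ?\<theta> * (b powr p / b powr p))"
      unfolding a_def b_def Lp_norm_powr
      using Lp_integrable[OF u] Lp_integrable[OF v] by simp
    also have "\<dots> = (a + b) powr p" using 3 by simp
    finally have "Lp_norm p \<rho> (\<lambda>x. u x + v x) \<le> ((a + b) powr p) powr (1 / p)"
      unfolding Lp_norm_def using p rho_pos
      by (intro powr_mono2 integral_nonneg_AE) (auto simp: less_imp_le)
    also have "\<dots> = a + b" using 3 p by (simp add: powr_powr)
    finally show ?thesis by (simp add: a_def b_def)
  qed
qed

end

section \<open>Convolution in the weighted space\<close>

text \<open>Prerequisite of Tonelli's theorem in \<open>conv_Lp\<close>, which is applied to the
  product of two copies of the completed measure.\<close>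

lemma sigma_finite_lebesgue: "sigma_finite_measure (lebesgue :: 'a::euclidean_space measure)"
proof
  let ?A = "range (\<lambda>n::nat. cball (0::'a) n)"
  have "x \<in> \<Union> ?A" for x
    using real_arch_simple[of "norm x"] by simp
  then have "\<Union> ?A = space lebesgue" by auto
  moreover have "\<forall>a\<in>?A. emeasure lebesgue a \<noteq> \<infinity>"
    by (simp add: emeasure_cball)
  moreover have "?A \<subseteq> sets lebesgue"
    by (simp add: image_subset_iff)
  ultimately show "\<exists>A::'a set set. countable A \<and> A \<subseteq> sets lebesgue \<and> \<Union>A = space lebesgue \<and> (\<forall>a\<in>A. emeasure lebesgue a \<noteq> \<infinity>)"
    by (intro exI[of _ ?A]) simp
qed

locale convolution_kernel = doubling_weight p K \<rho>
  for p K :: real and \<rho> :: "'a::euclidean_space \<Rightarrow> real" +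
  fixes J :: "'a \<Rightarrow> real" and B :: real
  assumes J_cont: "continuous_on UNIV J"
    and J_nonneg: "\<And>x. 0 \<le> J x"
    and J_le: "\<And>x. J x \<le> B"
    and J_outside: "\<And>x. 1 < norm x \<Longrightarrow> J x = 0"
begin

definition vol :: real where "vol = unit_ball_vol DIM('a)"

text \<open>Jensen's inequality on the unit ball bounds (J * \<bar>u\<bar>)^p by B^p * vol^(p - 1)
  times the integral of \<bar>u\<bar>^p over the ball; K pays for moving the weight from the centre
  to the point of integration.\<close>

definition avg_const :: real where "avg_const = B powr p * vol powr (p - 1) * K"

text \<open>Bound for the operator norm of the convolution in the weighted space. The further factor
  \<open>vol\<close> is the measure of the set of centres whose unit ball contains a given
  point.\<close>

definition conv_bound :: real where "conv_bound = (avg_const * vol) powr (1 / p)"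

lemma B_nonneg: "0 \<le> B"
  using J_nonneg J_le order_trans by blast

lemma vol_pos: "0 < vol" by (simp add: vol_def)

lemma emeasure_unit_cball: "emeasure lebesgue (cball (x::'a) 1) = ennreal vol"
  by (simp add: emeasure_cball vol_def)

lemma measure_unit_cball: "measure lebesgue (cball (x::'a) 1) = vol"
  using vol_pos by (simp add: measure_def emeasure_cball vol_def)

lemma avg_const_nonneg: "0 \<le> avg_const"
  using K_pos by (simp add: avg_const_def)

lemma J_shift_measurable: "(\<lambda>y. J (x - y)) \<in> borel_measurable lebesgue"
proof -
  have "continuous_on UNIV (\<lambda>y. J (x - y))"
    by (intro continuous_on_compose2[OF J_cont] continuous_intros) auto
  then show ?thesis
    by (intro measurable_completion) (simp add: borel_measurable_continuous_onI)
qed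

lemma J_shift_le: "\<bar>J (x - y) * c\<bar> \<le> B * (indicator (cball x 1) y * \<bar>c\<bar>)"
  using J_nonneg[of "x - y"] J_le[of "x - y"] J_outside[of "x - y"]
  by (auto simp: abs_mult indicator_def dist_norm not_le intro: mult_right_mono)

lemma conv_integrable:
  assumes u: "u \<in> Lp_space p \<rho>"
  shows "integrable lebesgue (\<lambda>y. J (x - y) * u y)"
proof (rule Bochner_Integration.integrable_bound)
  show "integrable lebesgue (\<lambda>y. B * (indicator (cball x 1) y * \<bar>u y\<bar>))"
    using set_integrable_abs[OF Lp_unit_ball_integrable[OF u]]
    by (intro integrable_mult_right) (simp add: set_integrable_def)
  show "(\<lambda>y. J (x - y) * u y) \<in> borel_measurable lebesgue"
    by (intro borel_measurable_times J_shift_measurable Lp_measurable u)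
  show "AE y in lebesgue. norm (J (x - y) * u y) \<le> norm (B * (indicator (cball x 1) y * \<bar>u y\<bar>))"
    using J_shift_le by (intro AE_I2) (simp only: real_norm_def, rule order_trans[OF _ abs_ge_self], simp)
qed

lemma conv_add:
  "u \<in> Lp_space p \<rho> \<Longrightarrow> v \<in> Lp_space p \<rho> \<Longrightarrow> conv J (\<lambda>y. u y + v y) x = conv J u x + conv J v x"
  by (simp add: conv_def distrib_left conv_integrable)

lemma conv_diff:
  "u \<in> Lp_space p \<rho> \<Longrightarrow> v \<in> Lp_space p \<rho> \<Longrightarrow> conv J (\<lambda>y. u y - v y) x = conv J u x - conv J v x"
  by (simp add: conv_def right_diff_distrib conv_integrable)

lemma conv_cmult: "conv J (\<lambda>y. c * u y) x = c * conv J u x"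
  unfolding conv_def by (subst mult.left_commute) simp

lemma conv_mono:
  assumes "u \<in> Lp_space p \<rho>" "v \<in> Lp_space p \<rho>" "\<And>y. u y \<le> v y"
  shows "conv J u x \<le> conv J v x"
  unfolding conv_def
  by (intro integral_mono conv_integrable assms mult_left_mono J_nonneg)

lemma conv_nonneg: "(\<And>y. 0 \<le> u y) \<Longrightarrow> 0 \<le> conv J u x"
  unfolding conv_def by (intro integral_nonneg_AE AE_I2 mult_nonneg_nonneg J_nonneg)

lemma abs_conv_le: "\<bar>conv J u x\<bar> \<le> conv J (\<lambda>y. \<bar>u y\<bar>) x"
  unfolding conv_def using integral_norm_bound[of lebesgue "\<lambda>y. J (x - y) * u y"]
  by (simp add: abs_mult J_nonneg)

text \<open>Along a convergent sequence all shifted kernels vanish outside one ball of radius R + 1,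
  where u is integrable, so dominated convergence applies. This regularity lets the nonlinear term
  of \<open>solution_exists\<close> live in a space of continuous functions.\<close>

lemma conv_continuous:
  assumes u: "u \<in> Lp_space p \<rho>"
  shows "continuous_on UNIV (conv J u)"
  unfolding continuous_on_sequentially
proof (intro allI ballI impI, elim conjE)
  fix X :: "nat \<Rightarrow> 'a" and x assume X: "X \<longlonglongrightarrow> x"
  then have "bounded (range X)" by (rule convergent_imp_bounded)
  then obtain R where R: "\<And>n. norm (X n) \<le> R"
    by (auto simp: bounded_iff)
  have loc: "set_integrable lebesgue (cball 0 (R + 1)) u"
    using u by (simp add: Lp_space_def L1_loc_def)
  have "(\<lambda>n. \<integral>y. J (X n - y) * u y \<partial>lebesgue) \<longlonglongrightarrow> (\<integral>y. J (x - y) * u y \<partial>lebesgue)"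
  proof (rule integral_dominated_convergence)
    show "integrable lebesgue (\<lambda>y. B * (indicator (cball 0 (R + 1)) y * \<bar>u y\<bar>))"
      using set_integrable_abs[OF loc] by (intro integrable_mult_right) (simp add: set_integrable_def)
    show "AE y in lebesgue. (\<lambda>n. J (X n - y) * u y) \<longlonglongrightarrow> J (x - y) * u y"
      by (intro AE_I2 tendsto_intros continuous_on_tendsto_compose[OF J_cont] X) auto
    show "AE y in lebesgue. norm (J (X n - y) * u y) \<le> B * (indicator (cball 0 (R + 1)) y * \<bar>u y\<bar>)" for n
    proof (rule AE_I2)
      fix y
      have "indicator (cball (X n) 1) y \<le> (indicator (cball 0 (R + 1)) y :: real)"
        using R[of n] norm_triangle_ineq2[of y "X n"]
        by (auto simp: indicator_def dist_norm norm_minus_commute)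
      then have "B * (indicator (cball (X n) 1) y * \<bar>u y\<bar>) \<le> B * (indicator (cball 0 (R + 1)) y * \<bar>u y\<bar>)"
        by (intro mult_left_mono mult_right_mono B_nonneg) auto
      then show "norm (J (X n - y) * u y) \<le> B * (indicator (cball 0 (R + 1)) y * \<bar>u y\<bar>)"
        using J_shift_le[of "X n" y "u y"] by simp
    qed
  qed (intro borel_measurable_times J_shift_measurable Lp_measurable u)+
  then show "(conv J u \<circ> X) \<longlonglongrightarrow> conv J u x"
    by (simp add: conv_def o_def)
qed

lemma conv_measurable:
  assumes "u \<in> Lp_space p \<rho>"
  shows "conv J u \<in> borel_measurable lebesgue"
  using conv_continuous[OF assms]
  by (intro measurable_completion) (simp add: borel_measurable_continuous_onI)

text \<open>As J is at most B and vanishes outside the unit ball, J * \<bar>u\<bar> is at most B *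
  vol times the mean m of \<bar>u\<bar> over the ball around x. Jensen's inequality moves the power
  inside the mean, and doubling replaces \<rho> x by K * \<rho> y. The ball integral is kept on the
  right because \<open>conv_Lp\<close> integrates it over x.\<close>

lemma conv_powr_le_ball_integral:
  assumes u: "u \<in> Lp_space p \<rho>"
  shows "conv J (\<lambda>y. \<bar>u y\<bar>) x powr p * \<rho> x
    \<le> avg_const * (\<integral>y. indicator (cball x 1) y * (\<bar>u y\<bar> powr p * \<rho> y) \<partial>lebesgue)"
proof -
  let ?C = "indicator (cball x 1) :: 'a \<Rightarrow> real"
  define I where "I = (\<integral>y. ?C y * \<bar>u y\<bar> \<partial>lebesgue)"
  have int_u: "integrable lebesgue (\<lambda>y. ?C y * \<bar>u y\<bar>)"
    using set_integrable_abs[OF Lp_unit_ball_integrable[OF u, of x]] by (simp add: set_integrable_def)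
  have int_C: "integrable lebesgue ?C"
    by (intro integrable_real_indicator) (auto simp: emeasure_unit_cball)
  have int_r: "integrable lebesgue (\<lambda>y. ?C y * (\<bar>u y\<bar> powr p * \<rho> y))"
    using integrable_real_mult_indicator[OF _ Lp_integrable[OF u], of "cball x 1"]
    by (simp add: mult.commute)
  have I: "0 \<le> I" unfolding I_def by (intro integral_nonneg_AE) auto
  have conv_le: "conv J (\<lambda>y. \<bar>u y\<bar>) x \<le> B * I"
  proof -
    have "conv J (\<lambda>y. \<bar>u y\<bar>) x \<le> (\<integral>y. B * (?C y * \<bar>u y\<bar>) \<partial>lebesgue)"
      unfolding conv_def
      using J_shift_le[of x _ "\<bar>u _\<bar>"] J_nonneg
      by (intro integral_mono conv_integrable Lp_abs u integrable_mult_right int_u)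
        (auto simp: abs_mult)
    then show ?thesis by (simp add: I_def)
  qed
  define m where "m = I / vol"
  have rhs: "vol * m powr p * \<rho> x \<le> K * (\<integral>y. ?C y * (\<bar>u y\<bar> powr p * \<rho> y) \<partial>lebesgue)"
  proof (cases "I = 0")
    case True
    have "0 \<le> (\<integral>y. ?C y * (\<bar>u y\<bar> powr p * \<rho> y) \<partial>lebesgue)"
      using rho_pos by (intro integral_nonneg_AE) (auto simp: less_imp_le)
    then show ?thesis using True K_pos p by (simp add: m_def)
  next
    case False
    then have m: "0 < m" using I vol_pos by (simp add: m_def)
    \<comment> \<open>This is \<rho> x times the supporting line at the mean, cut off to the ball.
      Its linear term integrates to zero, which leaves exactly vol * m^p * \<rho> x.\<close>
    let ?T = "\<lambda>y. \<rho> x * (m powr p * ?C y + p * m powr (p - 1) * (?C y * \<bar>u y\<bar> - m * ?C y))"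
    have "vol * m powr p * \<rho> x = (\<integral>y. ?T y \<partial>lebesgue)"
      using int_u int_C vol_pos
      by (simp add: I_def[symmetric] measure_unit_cball) (simp add: m_def)
    also have "\<dots> \<le> (\<integral>y. K * (?C y * (\<bar>u y\<bar> powr p * \<rho> y)) \<partial>lebesgue)"
    proof (intro integral_mono)
      fix y
      show "?T y \<le> K * (?C y * (\<bar>u y\<bar> powr p * \<rho> y))"
      proof (cases "y \<in> cball x 1")
        case True
        have "m powr p + p * m powr (p - 1) * (\<bar>u y\<bar> - m) \<le> \<bar>u y\<bar> powr p"
          using p m by (intro powr_above_tangent) auto
        then have "?T y \<le> \<rho> x * \<bar>u y\<bar> powr p"
          using True rho_pos[of x] by (intro mult_left_mono) auto
        also have "\<dots> \<le> (K * \<rho> y) * \<bar>u y\<bar> powr p"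
          using True by (intro mult_right_mono rho_doubling) (auto simp: dist_norm)
        finally show ?thesis using True by (simp add: algebra_simps)
      qed simp
    qed (use int_u int_C int_r in auto)
    finally show ?thesis by simp
  qed
  have m_nonneg: "0 \<le> m" using I vol_pos by (simp add: m_def)
  have "conv J (\<lambda>y. \<bar>u y\<bar>) x powr p \<le> (B * (vol * m)) powr p"
    using conv_le p vol_pos by (intro powr_mono2 conv_nonneg) (auto simp: m_def)
  also have "\<dots> = B powr p * vol powr (p - 1) * (vol * m powr p)"
    using B_nonneg vol_pos m_nonneg by (simp add: powr_mult powr_diff)
  finally have "conv J (\<lambda>y. \<bar>u y\<bar>) x powr p * \<rho> x \<le> B powr p * vol powr (p - 1) * (vol * m powr p) * \<rho> x"
    using rho_pos[of x] by (intro mult_right_mono) auto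
  also have "\<dots> = B powr p * vol powr (p - 1) * (vol * m powr p * \<rho> x)"
    by simp
  also have "\<dots> \<le> B powr p * vol powr (p - 1) * (K * (\<integral>y. ?C y * (\<bar>u y\<bar> powr p * \<rho> y) \<partial>lebesgue))"
    by (intro mult_left_mono rhs) auto
  finally show ?thesis by (simp add: avg_const_def mult.assoc)
qed

text \<open>The bound holds at every single point x; \<open>resolvent_majorant\<close> uses it to
  obtain limits everywhere and not just almost everywhere.\<close>

lemma conv_powr_le:
  assumes u: "u \<in> Lp_space p \<rho>"
  shows "conv J (\<lambda>y. \<bar>u y\<bar>) x powr p * \<rho> x \<le> avg_const * Lp_norm p \<rho> u powr p"
proof -
  have "(\<integral>y. indicator (cball x 1) y * (\<bar>u y\<bar> powr p * \<rho> y) \<partial>lebesgue)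
      \<le> (\<integral>y. \<bar>u y\<bar> powr p * \<rho> y \<partial>lebesgue)"
    using integrable_real_mult_indicator[OF _ Lp_integrable[OF u], of "cball x 1"] rho_pos
    by (intro integral_mono Lp_integrable u) (auto simp: indicator_def mult.commute less_imp_le)
  then show ?thesis
    unfolding Lp_norm_powr using conv_powr_le_ball_integral[OF u, of x] avg_const_nonneg
    by (meson mult_left_mono order_trans)
qed

text \<open>The ball estimate is integrated over x and the integrals are exchanged: the relation
  dist x y \<le> 1 is symmetric, so for fixed y the points x fill a ball of measure
  \<open>vol\<close>. Working with \<bar>u\<bar> keeps all integrands non-negative; J * u is
  dominated by J * \<bar>u\<bar> at the end.\<close>

lemma conv_Lp:
  assumes u: "u \<in> Lp_space p \<rho>"
  shows "conv J u \<in> Lp_space p \<rho>" "Lp_norm p \<rho> (conv J u) \<le> conv_bound * Lp_norm p \<rho> u"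
proof -
  let ?v = "conv J (\<lambda>y. \<bar>u y\<bar>)"
  let ?g = "\<lambda>y. \<bar>u y\<bar> powr p * \<rho> y"
  interpret lb: sigma_finite_measure "lebesgue :: 'a measure" by (rule sigma_finite_lebesgue)
  interpret pair_sigma_finite "lebesgue :: 'a measure" "lebesgue :: 'a measure" ..
  have g_nonneg: "0 \<le> ?g y" for y using rho_pos[of y] by simp
  have v_nonneg: "0 \<le> ?v x" for x by (intro conv_nonneg) auto
  have g_meas [measurable]: "?g \<in> borel_measurable lebesgue"
    using Lp_integrable[OF u] by auto
  \<comment> \<open>Both coordinate projections are Borel measurable on the product, because the
    identity is Borel measurable on \<open>lebesgue\<close>; hence so is the distance.\<close>
  have ball_meas: "{z \<in> space (lebesgue \<Otimes>\<^sub>M lebesgue). dist (fst z) (snd z :: 'a) \<le> 1} \<in> sets (lebesgue \<Otimes>\<^sub>M lebesgue)"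
  proof -
    have id: "(\<lambda>x. x) \<in> borel_measurable (lebesgue :: 'a measure)"
      by (intro measurable_completion) simp
    have "(\<lambda>z. fst z) \<in> borel_measurable ((lebesgue :: 'a measure) \<Otimes>\<^sub>M (lebesgue :: 'a measure))"
      "(\<lambda>z. snd z) \<in> borel_measurable ((lebesgue :: 'a measure) \<Otimes>\<^sub>M (lebesgue :: 'a measure))"
      using measurable_compose[OF measurable_fst id] measurable_compose[OF measurable_snd id] by auto
    then have "(\<lambda>z. dist (fst z) (snd z)) \<in> borel_measurable ((lebesgue :: 'a measure) \<Otimes>\<^sub>M lebesgue)"
      by (rule borel_measurable_dist)
    then show ?thesis by (rule borel_measurable_le) simp
  qed
  define D where "D = {z \<in> space ((lebesgue :: 'a measure) \<Otimes>\<^sub>M (lebesgue :: 'a measure)). dist (fst z) (snd z) \<le> 1}"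
  have D_ind: "indicator D (x, y) = indicator (cball x 1) y" "indicator D (x, y) = indicator (cball y 1) x" for x y
    by (auto simp: D_def indicator_def space_pair_measure dist_commute)
  have F_meas: "(\<lambda>(x, y). indicator D (x, y) * ennreal (?g y)) \<in> borel_measurable (lebesgue \<Otimes>\<^sub>M lebesgue)"
  proof -
    have "(\<lambda>z. ennreal (?g (snd z))) \<in> borel_measurable ((lebesgue :: 'a measure) \<Otimes>\<^sub>M lebesgue)"
      using measurable_compose[OF measurable_snd g_meas] by auto
    then have "(\<lambda>z. indicator D z * ennreal (?g (snd z))) \<in> borel_measurable ((lebesgue :: 'a measure) \<Otimes>\<^sub>M lebesgue)"
      by (intro borel_measurable_times_ennreal borel_measurable_indicator) (use ball_meas in \<open>simp_all add: D_def\<close>)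
    then show ?thesis by (simp add: case_prod_beta')
  qed
  have "(\<integral>\<^sup>+x. ennreal (?v x powr p * \<rho> x) \<partial>lebesgue)
      \<le> (\<integral>\<^sup>+x. ennreal avg_const * (\<integral>\<^sup>+y. indicator D (x, y) * ennreal (?g y) \<partial>lebesgue) \<partial>lebesgue)"
  proof (intro nn_integral_mono)
    fix x
    have "ennreal (?v x powr p * \<rho> x) \<le> ennreal (avg_const * (\<integral>y. indicator (cball x 1) y * ?g y \<partial>lebesgue))"
      by (intro ennreal_leI conv_powr_le_ball_integral u)
    also have "\<dots> = ennreal avg_const * (\<integral>\<^sup>+y. ennreal (indicator (cball x 1) y * ?g y) \<partial>lebesgue)"
      using integrable_real_mult_indicator[OF _ Lp_integrable[OF u], of "cball x 1"] g_nonneg avg_const_nonneg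
      by (subst nn_integral_eq_integral) (auto simp: mult.commute ennreal_mult' intro!: AE_I2 mult_nonneg_nonneg)
    also have "\<dots> = ennreal avg_const * (\<integral>\<^sup>+y. indicator D (x, y) * ennreal (?g y) \<partial>lebesgue)"
      unfolding D_ind(1) by (intro arg_cong2[where f="(*)"] refl nn_integral_cong) (auto simp: indicator_def)
    finally show "ennreal (?v x powr p * \<rho> x) \<le> \<dots>" .
  qed
  also have "\<dots> = ennreal avg_const * (\<integral>\<^sup>+x. (\<integral>\<^sup>+y. indicator D (x, y) * ennreal (?g y) \<partial>lebesgue) \<partial>lebesgue)"
    by (intro nn_integral_cmult) (use lb.borel_measurable_nn_integral_fst[OF F_meas] in simp)
  also have "(\<integral>\<^sup>+x. (\<integral>\<^sup>+y. indicator D (x, y) * ennreal (?g y) \<partial>lebesgue) \<partial>lebesgue)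
      = (\<integral>\<^sup>+y. (\<integral>\<^sup>+x. indicator D (x, y) * ennreal (?g y) \<partial>lebesgue) \<partial>lebesgue)"
    using Fubini[OF F_meas] by simp
  also have "\<dots> = (\<integral>\<^sup>+y. ennreal vol * ennreal (?g y) \<partial>lebesgue)"
    unfolding D_ind(2) by (intro nn_integral_cong, subst nn_integral_multc) (simp_all add: emeasure_cball vol_def borel_measurable_indicator)
  also have "\<dots> = ennreal vol * (\<integral>\<^sup>+y. ennreal (?g y) \<partial>lebesgue)"
    by (intro nn_integral_cmult) simp
  also have "\<dots> = ennreal vol * ennreal (Lp_norm p \<rho> u powr p)"
    unfolding Lp_norm_powr using g_nonneg by (subst nn_integral_eq_integral[OF Lp_integrable[OF u]]) auto
  also have "ennreal avg_const * (ennreal vol * ennreal (Lp_norm p \<rho> u powr p))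
      = ennreal (avg_const * vol * Lp_norm p \<rho> u powr p)"
    using avg_const_nonneg vol_pos by (simp add: ennreal_mult' mult.assoc)
  finally have le: "(\<integral>\<^sup>+x. ennreal (?v x powr p * \<rho> x) \<partial>lebesgue) \<le> ennreal (avg_const * vol * Lp_norm p \<rho> u powr p)" .
  have v_meas: "?v \<in> borel_measurable lebesgue"
    by (intro conv_measurable Lp_abs u)
  have int: "integrable lebesgue (\<lambda>x. ?v x powr p * \<rho> x)"
  proof (rule integrableI_bounded)
    show "(\<lambda>x. ?v x powr p * \<rho> x) \<in> borel_measurable lebesgue"
      using v_meas by (intro borel_measurable_times powr_real_measurable) auto
    have "(\<integral>\<^sup>+x. ennreal (norm (?v x powr p * \<rho> x)) \<partial>lebesgue) = (\<integral>\<^sup>+x. ennreal (?v x powr p * \<rho> x) \<partial>lebesgue)"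
      using rho_pos by (intro nn_integral_cong) (simp add: abs_mult abs_of_pos)
    then show "(\<integral>\<^sup>+x. ennreal (norm (?v x powr p * \<rho> x)) \<partial>lebesgue) < \<infinity>"
      using le by (simp add: order_le_less_trans)
  qed
  have v: "?v \<in> Lp_space p \<rho>"
    using int v_meas v_nonneg by (simp add: Lp_space_iff)
  have "(\<integral>x. ?v x powr p * \<rho> x \<partial>lebesgue) \<le> avg_const * vol * Lp_norm p \<rho> u powr p"
    using le avg_const_nonneg vol_pos rho_pos
    by (subst (asm) nn_integral_eq_integral[OF int]) (auto simp: less_imp_le ennreal_le_iff)
  then have "Lp_norm p \<rho> ?v \<le> (avg_const * vol * Lp_norm p \<rho> u powr p) powr (1 / p)"
    unfolding Lp_norm_def[of p \<rho> ?v] using p v_nonneg rho_pos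
    by (intro powr_mono2 integral_nonneg_AE) (auto simp: less_imp_le)
  also have "\<dots> = conv_bound * Lp_norm p \<rho> u"
    using avg_const_nonneg vol_pos p Lp_norm_nonneg[of u]
    by (simp add: powr_mult powr_powr conv_bound_def)
  finally have v_norm: "Lp_norm p \<rho> ?v \<le> conv_bound * Lp_norm p \<rho> u" .
  have "\<bar>conv J u x\<bar> \<le> \<bar>?v x\<bar>" for x
    using abs_conv_le[of u x] by simp
  from Lp_bound[OF conv_measurable[OF u] v this] v_norm
  show "conv J u \<in> Lp_space p \<rho>" "Lp_norm p \<rho> (conv J u) \<le> conv_bound * Lp_norm p \<rho> u"
    by auto
qed

end

section \<open>A weight that dominates its own convolution up to a constant\<close>

context convolution_kernel begin

text \<open>The iterates started at 0 increase to a solution of W = G + l * (J * W). Since J * W is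
  non-negative this gives G \<le> W, and since G is non-negative it gives J * W = (W - G) / l \<le>
  W / l, so \<Lambda> = 1 / l.\<close>

lemma resolvent_majorant:
  assumes G: "G \<in> Lp_space p \<rho>" and G_cont: "continuous_on UNIV G" and G_nonneg: "\<And>x. 0 \<le> G x"
  obtains W \<Lambda> where "W \<in> Lp_space p \<rho>" "continuous_on UNIV W" "\<And>x. G x \<le> W x"
    "0 \<le> \<Lambda>" "\<And>x. conv J W x \<le> \<Lambda> * W x"
proof -
  \<comment> \<open>This makes l times the operator bound at most 1/2; the added 1 avoids division
    by zero.\<close>
  define l where "l = 1 / (2 * conv_bound + 1)"
  have bound_nonneg: "0 \<le> conv_bound" by (simp add: conv_bound_def)
  then have l: "0 < l" "l * conv_bound \<le> 1 / 2"
    by (auto simp: l_def divide_simps)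
  define w where "w n = ((\<lambda>v x. G x + l * conv J v x) ^^ n) (\<lambda>x. 0)" for n :: nat
  have w_0: "w 0 = (\<lambda>x. 0)" and w_Suc: "w (Suc n) = (\<lambda>x. G x + l * conv J (w n) x)" for n
    by (simp_all add: w_def)
  have w_Lp: "w n \<in> Lp_space p \<rho>" for n
    by (induction n) (auto simp: w_0 w_Suc Lp_const intro!: Lp_add G Lp_cmult(1) conv_Lp(1))
  have w_nonneg: "0 \<le> w n x" for n x
    by (induction n arbitrary: x) (use l in \<open>auto simp: w_0 w_Suc intro!: add_nonneg_nonneg G_nonneg mult_nonneg_nonneg conv_nonneg\<close>)
  \<comment> \<open>The bound reproduces itself: a step yields at most the norm of G plus half of
    twice that norm.\<close>
  have w_norm: "Lp_norm p \<rho> (w n) \<le> 2 * Lp_norm p \<rho> G" for n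
  proof (induction n)
    case 0
    show ?case using p Lp_norm_nonneg[of G] by (simp add: w_0 Lp_norm_def)
  next
    case (Suc n)
    have "Lp_norm p \<rho> (w (Suc n)) \<le> Lp_norm p \<rho> G + l * Lp_norm p \<rho> (conv J (w n))"
      using Lp_norm_triangle[OF G Lp_cmult(1)[OF conv_Lp(1)[OF w_Lp]], of l n] Lp_cmult(2)[OF conv_Lp(1)[OF w_Lp], of l n] l
      by (simp add: w_Suc)
    also have "l * Lp_norm p \<rho> (conv J (w n)) \<le> l * (conv_bound * (2 * Lp_norm p \<rho> G))"
      using l bound_nonneg Suc conv_Lp(2)[OF w_Lp, of n]
      by (intro mult_left_mono order_trans[OF conv_Lp(2)[OF w_Lp]]) auto
    also have "\<dots> = (l * conv_bound) * (2 * Lp_norm p \<rho> G)" by simp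
    also have "\<dots> \<le> 1 / 2 * (2 * Lp_norm p \<rho> G)"
      using l Lp_norm_nonneg[of G] by (intro mult_right_mono) auto
    finally show ?case by simp
  qed
  have w_step: "w n x \<le> w (Suc n) x" for n x
  proof (induction n arbitrary: x)
    case 0 show ?case using w_nonneg[of "Suc 0" x] by (simp add: w_0)
  next
    case (Suc n)
    then show ?case
      unfolding w_Suc[of "Suc n"] using l
      by (subst w_Suc) (intro add_left_mono mult_left_mono conv_mono w_Lp, auto)
  qed
  have w_inc: "incseq (\<lambda>n. w n x)" for x
    using w_step by (intro incseq_SucI)
  \<comment> \<open>\<open>M\<close> is a finite barrier at each x, obtained from
    \<open>conv_powr_le\<close>. It turns monotonicity into convergence at every point, where the
    norm bound alone would leave a null set.\<close>
  define M where "M x = G x + l * (avg_const * (2 * Lp_norm p \<rho> G) powr p / \<rho> x) powr (1 / p)" for x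
  have w_M: "w n x \<le> M x" for n x
  proof (cases n)
    case 0
    then show ?thesis using l G_nonneg by (simp add: w_0 M_def)
  next
    case (Suc n)
    have "conv J (w n) x powr p * \<rho> x \<le> avg_const * Lp_norm p \<rho> (w n) powr p"
      using conv_powr_le[OF w_Lp, of n x] w_nonneg by simp
    also have "\<dots> \<le> avg_const * (2 * Lp_norm p \<rho> G) powr p"
      using avg_const_nonneg w_norm p Lp_norm_nonneg by (intro mult_left_mono powr_mono2) auto
    finally have "conv J (w n) x powr p \<le> avg_const * (2 * Lp_norm p \<rho> G) powr p / \<rho> x"
      using rho_pos[of x] by (simp add: field_simps)
    then have "(conv J (w n) x powr p) powr (1 / p) \<le> (avg_const * (2 * Lp_norm p \<rho> G) powr p / \<rho> x) powr (1 / p)"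
      using p by (intro powr_mono2) auto
    then have "conv J (w n) x \<le> (avg_const * (2 * Lp_norm p \<rho> G) powr p / \<rho> x) powr (1 / p)"
      using p conv_nonneg[of "w n" x] w_nonneg by (simp add: powr_powr)
    then show ?thesis unfolding Suc w_Suc M_def using l by simp
  qed
  have "\<exists>L. (\<lambda>n. w n x) \<longlonglongrightarrow> L" for x
    using incseq_convergent[OF w_inc, of x "M x"] w_M by blast
  then obtain W where W_lim: "\<And>x. (\<lambda>n. w n x) \<longlonglongrightarrow> W x"
    by metis
  have w_W: "w n x \<le> W x" for n x
    by (rule incseq_le[OF w_inc W_lim])
  have W_meas: "W \<in> borel_measurable lebesgue"
    by (rule borel_measurable_LIMSEQ_real[OF W_lim Lp_measurable[OF w_Lp]])
  have W_nonneg: "0 \<le> W x" for x using w_W[of 0 x] by (simp add: w_0)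
  have W_Lp: "W \<in> Lp_space p \<rho>"
  proof -
    let ?N = "\<lambda>n. \<integral>x. \<bar>w n x\<bar> powr p * \<rho> x \<partial>lebesgue"
    have mono_pt: "\<bar>w m x\<bar> powr p * \<rho> x \<le> \<bar>w n x\<bar> powr p * \<rho> x" if "m \<le> n" for m n x
      using incseqD[OF w_inc that, of x] w_nonneg p rho_pos[of x]
      by (intro mult_right_mono powr_mono2) auto
    have "incseq ?N"
      by (intro monoI integral_mono Lp_integrable w_Lp mono_pt)
    moreover have "?N n \<le> (2 * Lp_norm p \<rho> G) powr p" for n
      unfolding Lp_norm_powr[symmetric]
      using w_norm p Lp_norm_nonneg by (intro powr_mono2) auto
    ultimately obtain L where L: "?N \<longlonglongrightarrow> L"
      using incseq_convergent[of ?N] by blast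
    have "integrable lebesgue (\<lambda>x. \<bar>W x\<bar> powr p * \<rho> x)"
    proof (rule integrable_monotone_convergence)
      show "integrable lebesgue (\<lambda>x. \<bar>w n x\<bar> powr p * \<rho> x)" for n
        by (intro Lp_integrable w_Lp)
      show "AE x in lebesgue. mono (\<lambda>n. \<bar>w n x\<bar> powr p * \<rho> x)"
        using mono_pt by (intro AE_I2 monoI)
      show "AE x in lebesgue. (\<lambda>n. \<bar>w n x\<bar> powr p * \<rho> x) \<longlonglongrightarrow> \<bar>W x\<bar> powr p * \<rho> x"
        using p by (intro AE_I2 tendsto_intros tendsto_powr' W_lim) auto
      show "(\<lambda>x. \<bar>W x\<bar> powr p * \<rho> x) \<in> borel_measurable lebesgue"
        using W_meas by (intro borel_measurable_times powr_real_measurable borel_measurable_abs) auto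
    qed (rule L)
    then show ?thesis using W_meas by (simp add: Lp_space_iff)
  qed
  \<comment> \<open>In the limit of the recursion, J (x - y) * W y itself is the integrable
    majorant, because \<open>w n\<close> stays below W.\<close>
  have W_eq: "W x = G x + l * conv J W x" for x
  proof -
    have "(\<lambda>n. conv J (w n) x) \<longlonglongrightarrow> conv J W x"
      unfolding conv_def
    proof (rule integral_dominated_convergence)
      show "integrable lebesgue (\<lambda>y. J (x - y) * W y)" by (rule conv_integrable[OF W_Lp])
      show "AE y in lebesgue. (\<lambda>n. J (x - y) * w n y) \<longlonglongrightarrow> J (x - y) * W y"
        by (intro AE_I2 tendsto_intros W_lim)
      show "AE y in lebesgue. norm (J (x - y) * w n y) \<le> J (x - y) * W y" for n
        using w_nonneg w_W J_nonneg by (intro AE_I2) (simp add: abs_mult mult_left_mono)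
    qed (intro borel_measurable_times J_shift_measurable Lp_measurable W_Lp w_Lp)+
    then have "(\<lambda>n. w (Suc n) x) \<longlonglongrightarrow> G x + l * conv J W x"
      unfolding w_Suc by (intro tendsto_intros)
    then show ?thesis
      using LIMSEQ_unique LIMSEQ_Suc[OF W_lim] by blast
  qed
  show ?thesis
  proof (rule that[of W "1 / l"])
    \<comment> \<open>A monotone limit need not be continuous; continuity of W is read off from the
      fixed-point equation, whose right-hand side is continuous.\<close>
    have "continuous_on UNIV (\<lambda>x. G x + l * conv J W x)"
      by (intro continuous_intros G_cont conv_continuous W_Lp)
    then show "continuous_on UNIV W" by (simp flip: W_eq)
    show "G x \<le> W x" for x
      using W_eq[of x] l conv_nonneg[of W x] W_nonneg by simp
    show "conv J W x \<le> 1 / l * W x" for x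
      using W_eq[of x] l G_nonneg[of x] by (simp add: field_simps)
  qed (use W_Lp l in auto)
qed

end

section \<open>The neural field equation\<close>

text \<open>Puts the derivative into the form of \<open>Lp_has_derivative_curve\<close>, to which
  the linear map \<open>emb\<close> of \<open>solution_exists\<close> can be applied.\<close>

lemma has_vector_derivative_difference_quotient:
  assumes "(v has_vector_derivative D) (at t within S)"
  shows "((\<lambda>s. (v s - v t) /\<^sub>R (s - t) - D) \<longlongrightarrow> 0) (at t within S)"
proof (rule tendsto_norm_zero_cancel)
  have "((\<lambda>s. norm ((v s - v t) - (s - t) *\<^sub>R D) / norm (s - t)) \<longlongrightarrow> 0) (at t within S)"
    using assms by (simp add: has_vector_derivative_def has_derivative_iff_norm)
  moreover have "\<forall>\<^sub>F s in at t within S. norm ((v s - v t) - (s - t) *\<^sub>R D) / norm (s - t)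
      = norm ((v s - v t) /\<^sub>R (s - t) - D)"
    unfolding eventually_at_filter
  proof (intro always_eventually allI impI)
    fix s assume "s \<noteq> t"
    then have "(v s - v t) /\<^sub>R (s - t) - D = ((v s - v t) - (s - t) *\<^sub>R D) /\<^sub>R (s - t)"
      by (simp add: scaleR_diff_right)
    then show "norm ((v s - v t) - (s - t) *\<^sub>R D) / norm (s - t) = norm ((v s - v t) /\<^sub>R (s - t) - D)"
      by (simp add: divide_inverse mult.commute)
  qed
  ultimately show "((\<lambda>s. norm ((v s - v t) /\<^sub>R (s - t) - D)) \<longlongrightarrow> 0) (at t within S)"
    by (rule Lim_transform_eventually)
qed


text \<open>Pairs of a real and a bounded continuous function, on which the equation will be solved,
  thereby form a Banach space as \<open>global_solution_lipschitz_ode\<close> requires.\<close>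

instance bcontfun :: (metric_space, banach) banach ..

locale neural_field = convolution_kernel p K \<rho> J B
  for p K :: real and \<rho> J :: "'a::euclidean_space \<Rightarrow> real" and B :: real +
  fixes f :: "real \<Rightarrow> real" and h k :: real
  assumes k_nonneg: "0 \<le> k"
    and f_lipschitz: "\<And>x y. \<bar>f x - f y\<bar> \<le> k * \<bar>x - y\<bar>"
begin

abbreviation rhs :: "('a \<Rightarrow> real) \<Rightarrow> 'a \<Rightarrow> real" where
  "rhs \<equiv> neural_field_rhs J f h"

lemma f_measurable: "f \<in> borel_measurable borel"
proof -
  have "k-lipschitz_on UNIV f"
    using f_lipschitz k_nonneg by (intro lipschitz_onI) (auto simp: dist_real_def)
  then show ?thesis
    by (intro borel_measurable_continuous_onI lipschitz_on_continuous_on)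
qed

lemma f_growth: "\<bar>f x\<bar> \<le> \<bar>f 0\<bar> + k * \<bar>x\<bar>"
  using f_lipschitz[of x 0] by simp

lemma f_comp_Lp:
  assumes u: "u \<in> Lp_space p \<rho>"
  shows "f \<circ> u \<in> Lp_space p \<rho>"
proof (rule Lp_bound(1))
  show "f \<circ> u \<in> borel_measurable lebesgue"
    using measurable_compose[OF Lp_measurable[OF u] f_measurable] by (simp add: o_def)
  show "(\<lambda>x. \<bar>f 0\<bar> + k * \<bar>u x\<bar>) \<in> Lp_space p \<rho>"
    by (intro Lp_add Lp_const Lp_cmult(1) Lp_abs u)
  show "\<bar>(f \<circ> u) x\<bar> \<le> \<bar>\<bar>f 0\<bar> + k * \<bar>u x\<bar>\<bar>" for x
    using f_growth[of "u x"] by simp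
qed

lemma conv_f_lipschitz:
  assumes u: "u \<in> Lp_space p \<rho>" and v: "v \<in> Lp_space p \<rho>"
  shows "\<bar>conv J (f \<circ> u) x - conv J (f \<circ> v) x\<bar> \<le> k * conv J (\<lambda>y. \<bar>u y - v y\<bar>) x"
proof -
  note fuv = f_comp_Lp[OF u] f_comp_Lp[OF v]
  have "\<bar>conv J (f \<circ> u) x - conv J (f \<circ> v) x\<bar> = \<bar>conv J (\<lambda>y. (f \<circ> u) y - (f \<circ> v) y) x\<bar>"
    by (simp only: conv_diff[OF fuv])
  also have "\<dots> \<le> conv J (\<lambda>y. \<bar>(f \<circ> u) y - (f \<circ> v) y\<bar>) x"
    by (rule abs_conv_le)
  also have "\<dots> \<le> conv J (\<lambda>y. k * \<bar>u y - v y\<bar>) x"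
    using f_lipschitz by (intro conv_mono Lp_abs Lp_diff Lp_cmult(1) fuv u v) simp
  finally show ?thesis by (simp only: conv_cmult)
qed

lemma rhs_Lp:
  assumes u: "u \<in> Lp_space p \<rho>"
  shows "rhs u \<in> Lp_space p \<rho>"
proof -
  have "(\<lambda>x. (- 1) * u x + conv J (f \<circ> u) x + h) \<in> Lp_space p \<rho>"
    by (intro Lp_add Lp_cmult(1) conv_Lp(1) f_comp_Lp Lp_const u)
  then show ?thesis by (simp add: neural_field_rhs_def[abs_def])
qed

text \<open>The term -u contributes 1, and the nonlocal term the product of the Lipschitz constant
  of f with the operator bound; h drops out of differences.\<close>

definition rhs_lip :: real where "rhs_lip = 1 + k * conv_bound"

lemma rhs_lip_nonneg: "0 \<le> rhs_lip"
  using k_nonneg by (simp add: rhs_lip_def conv_bound_def)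

lemma rhs_lipschitz:
  assumes u: "u \<in> Lp_space p \<rho>" and v: "v \<in> Lp_space p \<rho>"
  shows "Lp_norm p \<rho> (\<lambda>x. rhs u x - rhs v x) \<le> rhs_lip * Lp_norm p \<rho> (\<lambda>x. u x - v x)"
proof -
  let ?d = "\<lambda>x. \<bar>u x - v x\<bar>"
  have d: "?d \<in> Lp_space p \<rho>" by (intro Lp_abs Lp_diff u v)
  have d_norm: "Lp_norm p \<rho> ?d = Lp_norm p \<rho> (\<lambda>x. u x - v x)"
    by (simp add: Lp_norm_def)
  have kd: "(\<lambda>x. k * conv J ?d x) \<in> Lp_space p \<rho>" by (intro Lp_cmult(1) conv_Lp(1) d)
  have "Lp_norm p \<rho> (\<lambda>x. rhs u x - rhs v x) \<le> Lp_norm p \<rho> (\<lambda>x. ?d x + k * conv J ?d x)"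
  proof (rule Lp_bound(2))
    show "(\<lambda>x. rhs u x - rhs v x) \<in> borel_measurable lebesgue"
      by (intro Lp_measurable Lp_diff rhs_Lp u v)
    show "(\<lambda>x. ?d x + k * conv J ?d x) \<in> Lp_space p \<rho>"
      by (intro Lp_add d kd)
    show "\<bar>rhs u x - rhs v x\<bar> \<le> \<bar>?d x + k * conv J ?d x\<bar>" for x
      using conv_f_lipschitz[OF u v, of x] by (simp add: neural_field_rhs_def)
  qed
  also have "\<dots> \<le> Lp_norm p \<rho> ?d + Lp_norm p \<rho> (\<lambda>x. k * conv J ?d x)"
    by (rule Lp_norm_triangle[OF d kd])
  also have "Lp_norm p \<rho> (\<lambda>x. k * conv J ?d x) = k * Lp_norm p \<rho> (conv J ?d)"
    using k_nonneg by (simp add: Lp_cmult(2)[OF conv_Lp(1)[OF d]])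
  also have "k * Lp_norm p \<rho> (conv J ?d) \<le> k * (conv_bound * Lp_norm p \<rho> ?d)"
    by (intro mult_left_mono conv_Lp(2) d k_nonneg)
  finally show ?thesis by (simp add: d_norm rhs_lip_def algebra_simps)
qed

text \<open>The increment of u - v from t to s is s - t times the sum of u' t - v' t and the two
  error quotients, the second with a minus sign. Near t each error has norm below \<epsilon> / 2,
  and the Lipschitz bound controls u' t - v' t. This supplies the hypothesis \<open>step\<close> of
  \<open>gronwall_dini\<close>.\<close>

lemma solution_difference_step:
  assumes u: "Lp_has_derivative_curve p \<rho> u u'" "AE x in lebesgue. u' t x = rhs (u t) x"
    and v: "Lp_has_derivative_curve p \<rho> v v'" "AE x in lebesgue. v' t x = rhs (v t) x"
    and t: "0 \<le> t" and e: "0 < \<epsilon>"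
  defines "D \<equiv> \<lambda>s. Lp_norm p \<rho> (\<lambda>x. u s x - v s x)"
  shows "\<forall>\<^sub>F s in at t within {0..}. \<bar>D s - D t\<bar> \<le> \<bar>s - t\<bar> * (rhs_lip * D t + \<epsilon>)"
proof -
  let ?q = "\<lambda>w w' s x. (w s x - w t x) / (s - t) - w' t x"
  have Lp: "u s \<in> Lp_space p \<rho>" "u' s \<in> Lp_space p \<rho>" "v s \<in> Lp_space p \<rho>" "v' s \<in> Lp_space p \<rho>"
    if "0 \<le> s" for s
    using u(1) v(1) that by (simp_all add: Lp_has_derivative_curve_def)
  have "((\<lambda>s. Lp_norm p \<rho> (?q u u' s)) \<longlongrightarrow> 0) (at t within {0..})"
    "((\<lambda>s. Lp_norm p \<rho> (?q v v' s)) \<longlongrightarrow> 0) (at t within {0..})"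
    using u(1) v(1) t by (simp_all add: Lp_has_derivative_curve_def)
  from this[THEN order_tendstoD(2), of "\<epsilon> / 2"]
  have "\<forall>\<^sub>F s in at t within {0..}. Lp_norm p \<rho> (?q u u' s) < \<epsilon> / 2"
    "\<forall>\<^sub>F s in at t within {0..}. Lp_norm p \<rho> (?q v v' s) < \<epsilon> / 2"
    using e by simp_all
  moreover have "\<forall>\<^sub>F s in at t within {0..}. s \<in> {0..} \<and> s \<noteq> t"
    by (simp add: eventually_at_filter)
  ultimately show ?thesis
  proof eventually_elim
    case (elim s)
    then have s: "0 \<le> s" "s \<noteq> t" by auto
    let ?d = "\<lambda>s x. u s x - v s x"
    let ?d' = "\<lambda>x. u' t x - v' t x"
    let ?r = "\<lambda>x. ?d s x - ?d t x"
    have d: "?d s \<in> Lp_space p \<rho>" "?d t \<in> Lp_space p \<rho>" "?d' \<in> Lp_space p \<rho>"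
      using Lp s t by (auto intro!: Lp_diff)
    have r: "?r \<in> Lp_space p \<rho>" by (intro Lp_diff d)
    have q: "?q w w' s \<in> Lp_space p \<rho>" if "w s \<in> Lp_space p \<rho>" "w t \<in> Lp_space p \<rho>" "w' t \<in> Lp_space p \<rho>"
      for w w' :: "real \<Rightarrow> 'a \<Rightarrow> real"
    proof -
      have "(\<lambda>x. 1 / (s - t) * (w s x - w t x) - w' t x) \<in> Lp_space p \<rho>"
        by (intro Lp_diff Lp_cmult(1) that)
      then show ?thesis by simp
    qed
    have qu: "?q u u' s \<in> Lp_space p \<rho>" and qv: "?q v v' s \<in> Lp_space p \<rho>"
      using q[of u u'] q[of v v'] Lp s t by auto
    have nqv: "(\<lambda>x. (-1) * ?q v v' s x) \<in> Lp_space p \<rho>" by (rule Lp_cmult(1)[OF qv])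
    have "Lp_norm p \<rho> ?d' = Lp_norm p \<rho> (\<lambda>x. rhs (u t) x - rhs (v t) x)"
    proof (rule Lp_norm_cong_AE)
      show "AE x in lebesgue. ?d' x = rhs (u t) x - rhs (v t) x"
        using u(2) v(2) by eventually_elim simp
    qed (intro Lp_measurable d Lp_diff rhs_Lp Lp t)+
    also have "\<dots> \<le> rhs_lip * D t"
      unfolding D_def by (intro rhs_lipschitz Lp t)
    finally have d': "Lp_norm p \<rho> ?d' \<le> rhs_lip * D t" .
    have "?r = (\<lambda>x. (s - t) * (?d' x + (?q u u' s x + (-1) * ?q v v' s x)))"
    proof
      fix x
      have id: "a - b = c * ((y - z) + ((a / c - y) + (-1) * (b / c - z)))" if "c \<noteq> 0" for a b c y z :: real
        using that by (simp add: field_simps)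
      show "?r x = (s - t) * (?d' x + (?q u u' s x + (-1) * ?q v v' s x))"
        using id[of "s - t" "u s x - u t x" "v s x - v t x" "u' t x" "v' t x"] s by simp
    qed
    then have "Lp_norm p \<rho> ?r = \<bar>s - t\<bar> * Lp_norm p \<rho> (\<lambda>x. ?d' x + (?q u u' s x + (-1) * ?q v v' s x))"
      using Lp_cmult(2)[OF Lp_add[OF d(3) Lp_add[OF qu nqv]], of "s - t"] by simp
    also have "\<dots> \<le> \<bar>s - t\<bar> * (rhs_lip * D t + \<epsilon>)"
    proof (rule mult_left_mono)
      have "Lp_norm p \<rho> (\<lambda>x. (-1) * ?q v v' s x) = Lp_norm p \<rho> (?q v v' s)"
        using Lp_cmult(2)[OF qv, of "-1"] by simp
      then show "Lp_norm p \<rho> (\<lambda>x. ?d' x + (?q u u' s x + (-1) * ?q v v' s x)) \<le> rhs_lip * D t + \<epsilon>"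
        using Lp_norm_triangle[OF d(3) Lp_add[OF qu nqv]] Lp_norm_triangle[OF qu nqv] d' elim
        by linarith
    qed simp
    finally have r_le: "Lp_norm p \<rho> ?r \<le> \<bar>s - t\<bar> * (rhs_lip * D t + \<epsilon>)" .
    have "D s \<le> Lp_norm p \<rho> ?r + D t"
      using Lp_norm_triangle[OF r d(2)] by (simp add: D_def)
    moreover have "D t \<le> Lp_norm p \<rho> ?r + D s"
      using Lp_norm_triangle[OF Lp_cmult(1)[OF r, of "-1"] d(1)] Lp_cmult(2)[OF r, of "-1"] by (simp add: D_def)
    ultimately show ?case using r_le by linarith
  qed
qed

text \<open>Used twice: equal initial values give uniqueness, and nearby ones give continuity of the
  solution map at time t. It applies to arbitrary solutions, not only to those built in
  \<open>solution_exists\<close>.\<close>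

lemma solution_difference_bound:
  assumes u: "Lp_ode_solution p \<rho> rhs u\<^sub>0 u" and v: "Lp_ode_solution p \<rho> rhs v\<^sub>0 v"
    and u0: "u\<^sub>0 \<in> Lp_space p \<rho>" and v0: "v\<^sub>0 \<in> Lp_space p \<rho>" and t: "0 \<le> t"
  shows "Lp_norm p \<rho> (\<lambda>x. u t x - v t x) \<le> exp (rhs_lip * t) * Lp_norm p \<rho> (\<lambda>x. u\<^sub>0 x - v\<^sub>0 x)"
proof -
  obtain u' where u': "Lp_has_derivative_curve p \<rho> u u'" "\<And>t. 0 \<le> t \<Longrightarrow> AE x in lebesgue. u' t x = rhs (u t) x"
    and u_init: "AE x in lebesgue. u 0 x = u\<^sub>0 x"
    using u unfolding Lp_ode_solution_def by blast
  obtain v' where v': "Lp_has_derivative_curve p \<rho> v v'" "\<And>t. 0 \<le> t \<Longrightarrow> AE x in lebesgue. v' t x = rhs (v t) x"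
    and v_init: "AE x in lebesgue. v 0 x = v\<^sub>0 x"
    using v unfolding Lp_ode_solution_def by blast
  have "Lp_norm p \<rho> (\<lambda>x. u t x - v t x) \<le> exp (rhs_lip * t) * Lp_norm p \<rho> (\<lambda>x. u 0 x - v 0 x)"
    by (rule gronwall_dini[OF rhs_lip_nonneg Lp_norm_nonneg _ t])
      (intro solution_difference_step[OF u'(1) u'(2) v'(1) v'(2)])
  also have "Lp_norm p \<rho> (\<lambda>x. u 0 x - v 0 x) = Lp_norm p \<rho> (\<lambda>x. u\<^sub>0 x - v\<^sub>0 x)"
  proof (rule Lp_norm_cong_AE)
    show "AE x in lebesgue. u 0 x - v 0 x = u\<^sub>0 x - v\<^sub>0 x"
      using u_init v_init by eventually_elim simp
    show "(\<lambda>x. u 0 x - v 0 x) \<in> borel_measurable lebesgue"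
      using u'(1) v'(1) by (intro Lp_measurable Lp_diff) (auto simp: Lp_has_derivative_curve_def)
    show "(\<lambda>x. u\<^sub>0 x - v\<^sub>0 x) \<in> borel_measurable lebesgue"
      by (intro Lp_measurable Lp_diff u0 v0)
  qed
  finally show ?thesis .
qed

section \<open>Existence of solutions\<close>

lemma solution_exists:
  assumes u0: "u\<^sub>0 \<in> Lp_space p \<rho>"
  obtains u where "Lp_ode_solution p \<rho> rhs u\<^sub>0 u"
proof -
  let ?a0 = "\<lambda>x. \<bar>u\<^sub>0 x\<bar>"
  have a0: "?a0 \<in> Lp_space p \<rho>" by (rule Lp_abs[OF u0])
  \<comment> \<open>The summand 1 forces W \<ge> 1, so that division by W is harmless and the
    constants h and f 0 are absorbed.\<close>
  obtain W \<Lambda> where W: "W \<in> Lp_space p \<rho>" "continuous_on UNIV W" "\<And>x. 1 + conv J ?a0 x \<le> W x"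
    and \<Lambda>: "0 \<le> \<Lambda>" "\<And>x. conv J W x \<le> \<Lambda> * W x"
  proof (rule resolvent_majorant[of "\<lambda>x. 1 + conv J ?a0 x"])
    show "(\<lambda>x. 1 + conv J ?a0 x) \<in> Lp_space p \<rho>" by (intro Lp_add Lp_const conv_Lp(1) a0)
    show "continuous_on UNIV (\<lambda>x. 1 + conv J ?a0 x)" by (intro continuous_intros conv_continuous a0)
    show "0 \<le> 1 + conv J ?a0 x" for x using conv_nonneg[of ?a0 x] by simp
  qed blast
  have W1: "1 \<le> W x" for x using W(3)[of x] conv_nonneg[of ?a0 x] by simp
  have W_nz: "W x \<noteq> 0" for x using W1[of x] by auto
  \<comment> \<open>V dominates every \<open>emb z\<close> up to the factor \<open>norm z\<close>.
    It contains \<bar>\<open>u\<^sub>0\<close>\<bar>, which W need not dominate, but J * V \<le> (1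
    + \<Lambda>) * W, so after one convolution the bound is again in terms of W.\<close>
  define V where "V x = ?a0 x + W x" for x
  have V: "V \<in> Lp_space p \<rho>" unfolding V_def[abs_def] by (intro Lp_add a0 W)
  have V1: "1 \<le> V x" for x using W1[of x] by (simp add: V_def)
  have conv_V: "conv J V x \<le> (1 + \<Lambda>) * W x" for x
  proof -
    have "conv J V x = conv J ?a0 x + conv J W x"
      unfolding V_def[abs_def] by (rule conv_add[OF a0 W(1)])
    then show ?thesis using W(3)[of x] \<Lambda>(2)[of x] by (simp add: distrib_right)
  qed
  \<comment> \<open>This map is linear in z and bounded into the weighted norm, with bound
    \<open>Lp_norm p \<rho> V\<close>; that is what carries limits and derivatives of curves over
    from the space of pairs.\<close>
  define emb where "emb z x = fst z * u\<^sub>0 x + W x * apply_bcontfun (snd z) x"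
    for z :: "real \<times> ('a \<Rightarrow>\<^sub>C real)" and x
  have emb_diff: "emb (z - w) x = emb z x - emb w x" for z w x
    by (simp add: emb_def algebra_simps)
  have emb_scale: "emb (c *\<^sub>R z) x = c * emb z x" for c z x
    by (simp add: emb_def algebra_simps)
  have nf: "norm (fst z) \<le> norm z" and ns: "norm (snd z) \<le> norm z" for z :: "real \<times> ('a \<Rightarrow>\<^sub>C real)"
    using norm_fst_le[of "fst z" "snd z"] norm_snd_le[of "snd z" "fst z"] by simp_all
  have emb_le: "\<bar>emb z x\<bar> \<le> norm z * V x" for z x
  proof -
    have "\<bar>emb z x\<bar> \<le> \<bar>fst z\<bar> * ?a0 x + W x * \<bar>apply_bcontfun (snd z) x\<bar>"
      using W1[of x] by (auto simp: emb_def abs_mult intro!: order_trans[OF abs_triangle_ineq])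
    also have "\<dots> \<le> norm z * ?a0 x + W x * norm z"
      using W1[of x] nf[of z] ns[of z] norm_bounded[of "snd z" x]
      by (intro add_mono mult_right_mono mult_left_mono) auto
    finally show ?thesis by (simp add: V_def algebra_simps)
  qed
  have emb_meas: "emb z \<in> borel_measurable lebesgue" for z
    unfolding emb_def[abs_def]
    by (intro borel_measurable_add borel_measurable_times borel_measurable_const Lp_measurable u0 W
        measurable_completion) (simp add: borel_measurable_continuous_onI)
  have emb_Lp: "emb z \<in> Lp_space p \<rho>" and emb_norm: "Lp_norm p \<rho> (emb z) \<le> norm z * Lp_norm p \<rho> V" for z
  proof -
    have le: "\<bar>emb z x\<bar> \<le> \<bar>norm z * V x\<bar>" for x
      using emb_le[of z x] by linarith
    show "emb z \<in> Lp_space p \<rho>"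
      by (rule Lp_bound(1)[OF emb_meas Lp_cmult(1)[OF V] le])
    show "Lp_norm p \<rho> (emb z) \<le> norm z * Lp_norm p \<rho> V"
      using Lp_bound(2)[OF emb_meas Lp_cmult(1)[OF V] le] by (simp add: Lp_cmult(2)[OF V])
  qed
  define g where "g z x = - apply_bcontfun (snd z) x + (h + conv J (f \<circ> emb z) x) / W x" for z x
  have conv_le: "\<bar>conv J (f \<circ> emb z) x\<bar> \<le> (\<bar>f 0\<bar> + k * norm z) * (1 + \<Lambda>) * W x" for z x
  proof -
    have "\<bar>conv J (f \<circ> emb z) x\<bar> \<le> conv J (\<lambda>y. \<bar>(f \<circ> emb z) y\<bar>) x" by (rule abs_conv_le)
    also have "\<dots> \<le> conv J (\<lambda>y. (\<bar>f 0\<bar> + k * norm z) * V y) x"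
    proof (intro conv_mono Lp_abs f_comp_Lp emb_Lp Lp_cmult(1) V)
      fix y
      have "\<bar>(f \<circ> emb z) y\<bar> \<le> \<bar>f 0\<bar> + k * \<bar>emb z y\<bar>" using f_growth by simp
      also have "\<dots> \<le> \<bar>f 0\<bar> * V y + k * (norm z * V y)"
        using emb_le V1[of y] mult_left_mono[OF V1, of "\<bar>f 0\<bar>" y] k_nonneg
        by (intro add_mono mult_left_mono) auto
      finally show "\<bar>(f \<circ> emb z) y\<bar> \<le> (\<bar>f 0\<bar> + k * norm z) * V y" by (simp add: algebra_simps)
    qed
    also have "\<dots> \<le> (\<bar>f 0\<bar> + k * norm z) * ((1 + \<Lambda>) * W x)"
      unfolding conv_cmult using k_nonneg conv_V by (intro mult_left_mono) auto
    finally show ?thesis by (simp only: mult.assoc)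
  qed
  have g_bcont: "g z \<in> bcontfun" for z
  proof (rule bcontfun_normI)
    show "continuous_on UNIV (g z)"
      unfolding g_def[abs_def]
      using W_nz by (intro continuous_intros conv_continuous f_comp_Lp emb_Lp W(2)) auto
    fix x
    have "\<bar>(h + conv J (f \<circ> emb z) x) / W x\<bar> \<le> \<bar>h\<bar> + (\<bar>f 0\<bar> + k * norm z) * (1 + \<Lambda>)"
    proof -
      have "\<bar>h + conv J (f \<circ> emb z) x\<bar> \<le> \<bar>h\<bar> * W x + (\<bar>f 0\<bar> + k * norm z) * (1 + \<Lambda>) * W x"
        using conv_le[of z x] mult_left_mono[OF W1, of "\<bar>h\<bar>" x] by linarith
      then show ?thesis using W1[of x] by (simp add: abs_divide divide_le_eq distrib_right)
    qed
    then show "norm (g z x) \<le> norm z + (\<bar>h\<bar> + (\<bar>f 0\<bar> + k * norm z) * (1 + \<Lambda>))"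
      using norm_bounded[of "snd z" x] ns[of z] unfolding g_def real_norm_def by linarith
  qed
  define H where "H z = (- fst z, Bcontfun (g z))" for z
  have H_apply: "apply_bcontfun (snd (H z)) x = g z x" for z x
    by (simp add: H_def Bcontfun_inverse g_bcont)
  \<comment> \<open>Each of the two components contributes 1 through its linear term, and the
    nonlinear term contributes k * (1 + \<Lambda>) through the bound on J * V. The norm of a pair is
    at most the sum of the norms of its components.\<close>
  have H_lip: "norm (H z - H w) \<le> (2 + k * (1 + \<Lambda>)) * norm (z - w)" for z w
  proof -
    have "\<bar>g z x - g w x\<bar> \<le> (1 + k * (1 + \<Lambda>)) * norm (z - w)" for x
    proof -
      have "\<bar>conv J (f \<circ> emb z) x - conv J (f \<circ> emb w) x\<bar> \<le> k * conv J (\<lambda>y. \<bar>emb z y - emb w y\<bar>) x"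
        by (intro conv_f_lipschitz emb_Lp)
      also have "\<dots> \<le> k * conv J (\<lambda>y. norm (z - w) * V y) x"
        by (intro mult_left_mono k_nonneg conv_mono Lp_abs Lp_diff Lp_cmult(1) V emb_Lp)
          (simp add: emb_le flip: emb_diff)
      also have "\<dots> \<le> k * (norm (z - w) * ((1 + \<Lambda>) * W x))"
        unfolding conv_cmult by (intro mult_left_mono k_nonneg conv_V) auto
      finally have "\<bar>(conv J (f \<circ> emb z) x - conv J (f \<circ> emb w) x) / W x\<bar> \<le> k * (1 + \<Lambda>) * norm (z - w)"
        using W1[of x] by (simp add: abs_divide divide_le_eq algebra_simps)
      moreover have "g z x - g w x = - apply_bcontfun (snd (z - w)) x
          + (conv J (f \<circ> emb z) x - conv J (f \<circ> emb w) x) / W x"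
        by (simp add: g_def diff_divide_distrib add_divide_distrib)
      ultimately show ?thesis
        using norm_bounded[of "snd (z - w)" x] ns[of "z - w"]
        unfolding real_norm_def distrib_right mult_1 by linarith
    qed
    then have "norm (snd (H z - H w)) \<le> (1 + k * (1 + \<Lambda>)) * norm (z - w)"
      by (intro norm_bound) (simp add: H_apply)
    moreover have "norm (fst (H z - H w)) \<le> norm (z - w)"
      using nf[of "z - w"] by (simp add: H_def abs_minus_commute)
    moreover have "norm (H z - H w) \<le> norm (fst (H z - H w)) + norm (snd (H z - H w))"
      using norm_Pair_le[of "fst (H z - H w)" "snd (H z - H w)"] by (simp only: prod.collapse)
    ultimately show ?thesis by (simp add: algebra_simps)
  qed
  \<comment> \<open>The factor W cancels the division in g, and the two linear parts together give
    -u. So \<open>emb\<close> intertwines H with \<open>rhs\<close> and sends solution curves to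
    solution curves.\<close>
  have emb_H: "emb (H z) x = rhs (emb z) x" for z x
    using W_nz[of x] by (simp add: emb_def[of "H z"] H_apply) (simp add: H_def g_def emb_def[of z] neural_field_rhs_def right_diff_distrib)
  obtain v where v0: "v 0 = (1, 0)"
    and v_deriv: "\<And>t. 0 \<le> t \<Longrightarrow> (v has_vector_derivative H (v t)) (at t within {0..})"
    by (rule global_solution_lipschitz_ode[of H "2 + k * (1 + \<Lambda>)" "(1, 0)"])
      (use H_lip k_nonneg \<Lambda>(1) in auto)
  have H_cont: "continuous_on UNIV H"
    by (rule lipschitz_on_continuous_on[of "2 + k * (1 + \<Lambda>)"], rule lipschitz_onI)
      (use H_lip k_nonneg \<Lambda>(1) in \<open>auto simp: dist_norm\<close>)
  have emb_tendsto: "((\<lambda>s. Lp_norm p \<rho> (emb (y s))) \<longlongrightarrow> 0) F" if "(y \<longlongrightarrow> 0) F" for y and F :: "real filter"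
  proof (rule Lim_null_comparison)
    show "\<forall>\<^sub>F s in F. norm (Lp_norm p \<rho> (emb (y s))) \<le> norm (y s) * Lp_norm p \<rho> V"
      using emb_norm Lp_norm_nonneg by (intro always_eventually) simp
    show "((\<lambda>s. norm (y s) * Lp_norm p \<rho> V) \<longlongrightarrow> 0) F"
      by (intro tendsto_mult_left_zero tendsto_norm_zero that)
  qed
  have "Lp_ode_solution p \<rho> rhs u\<^sub>0 (\<lambda>t. emb (v t))"
    unfolding Lp_ode_solution_def
  proof (intro conjI exI[of _ "\<lambda>t. emb (H (v t))"] allI impI)
    show "Lp_has_derivative_curve p \<rho> (\<lambda>t. emb (v t)) (\<lambda>t. emb (H (v t)))"
      unfolding Lp_has_derivative_curve_def
    proof (intro allI impI conjI emb_Lp)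
      fix t :: real assume t: "0 \<le> t"
      have "((\<lambda>s. (v s - v t) /\<^sub>R (s - t) - H (v t)) \<longlongrightarrow> 0) (at t within {0..})"
        by (rule has_vector_derivative_difference_quotient[OF v_deriv[OF t]])
      moreover have emb_quot: "emb ((v s - v t) /\<^sub>R (s - t) - H (v t))
          = (\<lambda>x. (emb (v s) x - emb (v t) x) / (s - t) - emb (H (v t)) x)" for s
        by (rule ext) (simp add: emb_diff emb_scale divide_inverse mult.commute)
      ultimately show "((\<lambda>s. Lp_norm p \<rho> (\<lambda>x. (emb (v s) x - emb (v t) x) / (s - t) - emb (H (v t)) x)) \<longlongrightarrow> 0) (at t within {0..})"
        using emb_tendsto by (simp only: emb_quot[symmetric])
    qed
    show "Lp_continuous_curve p \<rho> (\<lambda>t. emb (H (v t)))"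
      unfolding Lp_continuous_curve_def
    proof (intro allI impI conjI emb_Lp)
      fix t :: real assume t: "0 \<le> t"
      have "(v \<longlongrightarrow> v t) (at t within {0..})"
        using has_vector_derivative_continuous[OF v_deriv[OF t]] by (simp add: continuous_within)
      then have "((\<lambda>s. H (v s)) \<longlongrightarrow> H (v t)) (at t within {0..})"
        by (rule continuous_on_tendsto_compose[OF H_cont]) auto
      then have "((\<lambda>s. H (v s) - H (v t)) \<longlongrightarrow> 0) (at t within {0..})"
        by (simp add: Lim_null[symmetric])
      moreover have emb_fun_diff: "(\<lambda>x. emb z x - emb w x) = emb (z - w)" for z w
        by (rule ext) (simp add: emb_diff)
      ultimately show "((\<lambda>s. Lp_norm p \<rho> (\<lambda>x. emb (H (v s)) x - emb (H (v t)) x)) \<longlongrightarrow> 0) (at t within {0..})"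
        unfolding emb_fun_diff by (intro emb_tendsto)
    qed
    show "AE x in lebesgue. emb (H (v t)) x = rhs (emb (v t)) x" for t
      by (simp add: emb_H)
    show "AE x in lebesgue. emb (v 0) x = u\<^sub>0 x"
      by (simp add: v0 emb_def)
  qed
  then show ?thesis by (rule that)
qed

theorem globally_well_posed: "Lp_globally_well_posed p \<rho> rhs"
proof -
  \<comment> \<open>S is obtained by choice, so its construction says nothing about how it depends
    on the initial value; continuity comes from \<open>solution_difference_bound\<close>.\<close>
  obtain S where S: "\<And>u\<^sub>0. u\<^sub>0 \<in> Lp_space p \<rho> \<Longrightarrow> Lp_ode_solution p \<rho> rhs u\<^sub>0 (S u\<^sub>0)"
    by (metis solution_exists)
  have Lp: "u t \<in> Lp_space p \<rho>" if "Lp_ode_solution p \<rho> rhs u\<^sub>0 u" "0 \<le> t" for u u\<^sub>0 t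
    using that by (auto simp: Lp_ode_solution_def Lp_has_derivative_curve_def)
  show ?thesis
    unfolding Lp_globally_well_posed_def
  proof (intro exI[of _ S] conjI ballI allI impI)
    fix u\<^sub>0 assume u0: "u\<^sub>0 \<in> Lp_space p \<rho>"
    show "Lp_ode_solution p \<rho> rhs u\<^sub>0 (S u\<^sub>0)" by (rule S[OF u0])
    fix w and t :: real assume w: "Lp_ode_solution p \<rho> rhs u\<^sub>0 w" and t: "0 \<le> t"
    have "Lp_norm p \<rho> (\<lambda>x. w t x - S u\<^sub>0 t x) \<le> 0"
      using solution_difference_bound[OF w S[OF u0] u0 u0 t] p by (simp add: Lp_norm_def)
    then have "Lp_norm p \<rho> (\<lambda>x. w t x - S u\<^sub>0 t x) = 0"
      using Lp_norm_nonneg by (intro antisym)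
    then have "AE x in lebesgue. w t x - S u\<^sub>0 t x = 0"
      by (intro Lp_norm_eq_0D Lp_diff Lp[OF w t] Lp[OF S[OF u0] t])
    then show "AE x in lebesgue. w t x = S u\<^sub>0 t x" by simp
  next
    fix t :: real and u\<^sub>0 and \<epsilon> :: real
    assume t: "0 \<le> t" and u0: "u\<^sub>0 \<in> Lp_space p \<rho>" and e: "0 < \<epsilon>"
    show "\<exists>\<delta>>0. \<forall>v\<^sub>0\<in>Lp_space p \<rho>. Lp_norm p \<rho> (\<lambda>x. v\<^sub>0 x - u\<^sub>0 x) < \<delta> \<longrightarrow>
        Lp_norm p \<rho> (\<lambda>x. S v\<^sub>0 t x - S u\<^sub>0 t x) < \<epsilon>"
    \<comment> \<open>This \<delta> undoes the Gronwall growth factor up to time t.\<close>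
    proof (intro exI[of _ "\<epsilon> / exp (rhs_lip * t)"] conjI ballI impI)
      fix v\<^sub>0 assume v0: "v\<^sub>0 \<in> Lp_space p \<rho>"
        and "Lp_norm p \<rho> (\<lambda>x. v\<^sub>0 x - u\<^sub>0 x) < \<epsilon> / exp (rhs_lip * t)"
      then have "exp (rhs_lip * t) * Lp_norm p \<rho> (\<lambda>x. v\<^sub>0 x - u\<^sub>0 x) < \<epsilon>"
        by (simp add: less_divide_eq mult.commute)
      then show "Lp_norm p \<rho> (\<lambda>x. S v\<^sub>0 t x - S u\<^sub>0 t x) < \<epsilon>"
        using solution_difference_bound[OF S[OF v0] S[OF u0] v0 u0 t] by linarith
    qed (use e in simp)
  qed
qed

end

section \<open>From the hypotheses on J, f and \<rho> to the abstract setting\<close>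

theorem mainTheorem4:
  fixes J \<rho> :: "real ^ 'n \<Rightarrow> real"
    and f :: "real \<Rightarrow> real"
    and p h k\<^sub>1 K :: real
  assumes p: "1 < p"
    and h: "0 < h"
    and J_C1: "C1_function J"
    and J_nonneg: "\<And>x. 0 \<le> J x"
    and J_even: "\<And>x. J (- x) = J x"
    and J_supp: "closure {x. J x \<noteq> 0} \<subseteq> cball 0 1"
    and f_nonneg: "\<And>x. 0 \<le> f x"
    and f_mono: "mono f"
    and k1_pos: "0 < k\<^sub>1"
    and f_lipschitz: "\<And>x y. \<bar>f x - f y\<bar> \<le> k\<^sub>1 * \<bar>x - y\<bar>"
    and rho_integrable: "integrable lebesgue \<rho>"
    and rho_pos: "\<And>x. 0 < \<rho> x"
    and rho_even: "\<And>x. \<rho> (- x) = \<rho> x"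
    and rho_integral: "(\<integral>x. \<rho> x \<partial>lebesgue) = 1"
    and K_pos: "0 < K"
    and rho_sup: "\<And>y. (SUP x\<in>{x. norm (x - y) \<le> 1}. ereal (\<rho> x)) \<le> ereal (K * \<rho> y)"
  shows "Lp_globally_well_posed p \<rho> (neural_field_rhs J f h)"
proof -
  obtain J' where J': "\<And>x. (J has_derivative blinfun_apply (J' x)) (at x)"
    using J_C1 by (auto simp: C1_function_def)
  have J_cont: "continuous_on UNIV J"
    by (intro continuous_at_imp_continuous_on ballI has_derivative_continuous[OF J'])
  have J_outside: "J x = 0" if "1 < norm x" for x
  proof (rule ccontr)
    assume "J x \<noteq> 0"
    then have "x \<in> closure {x. J x \<noteq> 0}" by (intro subsetD[OF closure_subset]) simp
    then have "x \<in> cball 0 1" by (rule subsetD[OF J_supp])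
    then show False using that by simp
  qed
  have "bounded (J ` cball 0 1)"
    by (intro compact_imp_bounded compact_continuous_image continuous_on_subset[OF J_cont]) auto
  then obtain B where "\<And>x. x \<in> cball 0 1 \<Longrightarrow> norm (J x) \<le> B"
    unfolding bounded_iff ball_simps(9) by metis
  then have B: "J x \<le> B" if "norm x \<le> 1" for x
    using that by force
  \<comment> \<open>Compactness of the unit ball provides B; the maximum with 0 covers the points
    outside, where J vanishes.\<close>
  have J_le: "J x \<le> max B 0" for x
    using B[of x] J_outside[of x] by (cases "norm x \<le> 1") auto
  have doubling: "\<rho> x \<le> K * \<rho> y" if "norm (x - y) \<le> 1" for x y
  proof -
    have "ereal (\<rho> x) \<le> (SUP x\<in>{x. norm (x - y) \<le> 1}. ereal (\<rho> x))"
      using that by (intro SUP_upper) simp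
    also have "\<dots> \<le> ereal (K * \<rho> y)" by (rule rho_sup)
    finally show ?thesis by simp
  qed
  interpret neural_field p K \<rho> J "max B 0" f h k\<^sub>1
  proof
    show "1 < p" "integrable lebesgue \<rho>" "0 < K" by fact+
    show "0 \<le> k\<^sub>1" using k1_pos by simp
  qed (fact rho_pos doubling J_cont J_nonneg J_le J_outside f_lipschitz)+
  show ?thesis by (rule globally_well_posed)
qed

end
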